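(* Consider a continuous-price one-side limit order book with homogeneous Poisson arrival of (unit-size) market orders with intensity $\mu$, spatial Poisson arrival of (unit-size) limit orders with intensity $\lambda(p,t)=\alpha h_\lambda(p)$ (price $p\ge 0$, time $t\ge 0$), and exponentially distributed lifetimes of non-executed limit orders with parameter $\theta>0$. Let $h(p)=\alpha h_\lambda(p)/\theta$, let $B(p)=\mathbf E[L([0,p])]$ be the average cumulative shape of the order book up to price $p$, and let $b(p)=\frac{dB(p)}{dp}$ be the average shape of the order book. Then the shape of the order book can be written as $$b(p)=h(p)\,C(p),$$ where $C(p)$ is the probability that a limit order submitted at price $p$ will be cancelled before being executed.
   Context: One-side order book model: all limit orders are sell (ask) orders, all market orders are buy orders, and every order has unit size. Prices are non-negative reals. The function $h_\lambda:\mathbb R_+\to\mathbb R_+$ is the spatial intensity function of limit orders and $\alpha$ is a constant. Limit orders are the points of a Poisson process on (price, time) space $\mathbb R_+^2$ with intensity $\alpha h_\lambda(p)$; thus limit orders with price in $[p_1,p_2]$ arrive according to a homogeneous Poisson process of rate $\alpha\int_{p_1}^{p_2}h_\lambda(u)\,du$, and these processes are independent for disjoint price intervals. Market orders arrive according to an independent Poisson process of rate $\mu$; each market order executes (removes) the standing limit order with the lowest price, if any. Each standing limit order that has not been executed is cancelled after an exponential time of parameter $\theta$ from its submission; these times are mutually independent and independent of the arrivals. $L([0,p])$ denotes the number of limit orders with price in $[0,p]$ standing in the book. As a process in time it is a birth-and-death process on $\{0,1,2,\dots\}$ with birth rate $\alpha\int_0^p h_\lambda(u)\,du$ in every state and death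 rate $\mu+n\theta$ in state $n\ge1$; $\mathbf E[L([0,p])]$ is its mean under its stationary distribution. The probability $C(p)$ is understood as the fraction of limit orders submitted at price $p$ which are cancelled: it is the limit as $\epsilon\to0$ of the fraction, per unit time in the stationary regime, of the limit orders submitted at a price in $[p,p+\epsilon]$ that are cancelled (as opposed to executed).
   Formalization: The intensity function h_λ is assumed integrable on every [0,q] and continuous at the price p considered (otherwise dB/dp may fail to exist or differ from h(p)C(p), e.g. if h_λ is altered at one point); at p=0 the derivative b is one-sided. *)

theory Defs
  imports "HOL-Probability.Probability"
begin

section \<open>Stationary birth-and-death distributions\<close>

definition birth_death_rate ::
  "(nat \<Rightarrow> real) \<Rightarrow> (nat \<Rightarrow> real) \<Rightarrow> nat \<Rightarrow> nat \<Rightarrow> real" where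
  "birth_death_rate birth death i j =
     (if j = Suc i then birth i
      else if i = Suc j then death i
      else if j = i then - (birth i + (if i = 0 then 0 else death i))
      else 0)"

definition stationary_distribution :: "(nat \<Rightarrow> nat \<Rightarrow> real) \<Rightarrow> nat pmf \<Rightarrow> bool" where
  "stationary_distribution Q \<pi> \<longleftrightarrow> (\<forall>j. (\<lambda>i. pmf \<pi> i * Q i j) sums 0)"

definition limit_rate :: "real \<Rightarrow> (real \<Rightarrow> real) \<Rightarrow> real \<Rightarrow> real" where
  "limit_rate \<alpha> hl q = \<alpha> * (LINT u:{0..q}|lborel. hl u)"

text \<open>For \<open>\<theta> > 0\<close> the description in the following definition determines a unique
  distribution, for every rate of market orders \<open>\<mu> \<ge> 0\<close>.\<close>

definition book_law :: "real \<Rightarrow> (real \<Rightarrow> real) \<Rightarrow> real \<Rightarrow> real \<Rightarrow> real \<Rightarrow> nat pmf" where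
  "book_law \<alpha> hl \<mu> \<theta> q =
     (THE \<pi>. stationary_distribution
        (birth_death_rate (\<lambda>_. limit_rate \<alpha> hl q) (\<lambda>n. \<mu> + real n * \<theta>)) \<pi>)"

definition mean_cumulative_shape ::
  "real \<Rightarrow> (real \<Rightarrow> real) \<Rightarrow> real \<Rightarrow> real \<Rightarrow> real \<Rightarrow> real" where
  "mean_cumulative_shape \<alpha> hl \<mu> \<theta> q = measure_pmf.expectation (book_law \<alpha> hl \<mu> \<theta> q) real"

section \<open>Poisson processes\<close>

text \<open>A point process is given by the map \<open>D\<close> that sends a set \<open>A\<close> of locations to the
  random set \<open>D A \<omega>\<close> of (names of) points falling in \<open>A\<close>. The Poisson law is written
  out because \<open>poisson_pmf\<close> is only specified for a strictly positive rate.\<close>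

definition poisson_process ::
  "'w measure \<Rightarrow> ('b set \<Rightarrow> 'w \<Rightarrow> 'i set) \<Rightarrow> 'b measure \<Rightarrow> bool" where
  "poisson_process M D \<nu> \<longleftrightarrow>
     (\<forall>A\<in>sets \<nu>. emeasure \<nu> A < \<infinity> \<longrightarrow>
        (AE \<omega> in M. finite (D A \<omega>)) \<and>
        (\<lambda>\<omega>. card (D A \<omega>)) \<in> measurable M (count_space UNIV) \<and>
        (\<forall>k. measure M {\<omega> \<in> space M. card (D A \<omega>) = k} =
               measure \<nu> A ^ k / fact k * exp (- measure \<nu> A))) \<and>
     (\<forall>\<A>. finite \<A> \<and> disjoint \<A> \<and> \<A> \<subseteq> {A \<in> sets \<nu>. emeasure \<nu> A < \<infinity>} \<longrightarrow>
        prob_space.indep_vars M (\<lambda>_. count_space UNIV) (\<lambda>A \<omega>. card (D A \<omega>)) \<A>)"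

definition count_events ::
  "'w measure \<Rightarrow> ('b set \<Rightarrow> 'w \<Rightarrow> 'i set) \<Rightarrow> 'b set set \<Rightarrow> 'w set set" where
  "count_events M D \<A> = {{\<omega> \<in> space M. card (D A \<omega>) = k} |A k. A \<in> \<A>}"

section \<open>The order book\<close>

text \<open>Limit orders have names in \<open>nat\<close>; \<open>orders \<omega>\<close> is the set of names in use (it may be
  finite, or even empty when the intensity vanishes). An order with \<open>subm i \<omega> = 0\<close> belongs
  to the initial book, and \<open>life i \<omega>\<close> is then its residual lifetime, which has the same
  exponential law by lack of memory. The execution time \<open>exec i \<omega>\<close> is \<open>\<infinity>\<close> if the
  order is never executed.\<close>

record 'w order_book =
  orders :: "'w \<Rightarrow> nat set"
  price :: "nat \<Rightarrow> 'w \<Rightarrow> real"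
  subm :: "nat \<Rightarrow> 'w \<Rightarrow> real"
  life :: "nat \<Rightarrow> 'w \<Rightarrow> real"
  exec :: "nat \<Rightarrow> 'w \<Rightarrow> ereal"
  market :: "'w \<Rightarrow> real set"

definition standing :: "'w order_book \<Rightarrow> real \<Rightarrow> 'w \<Rightarrow> nat set" where
  "standing X t \<omega> =
     {i \<in> orders X \<omega>. subm X i \<omega> \<le> t \<and> t < subm X i \<omega> + life X i \<omega> \<and> ereal t < exec X i \<omega>}"

text \<open>The left limit of the book, i.e. the book a market order arriving at time \<open>t\<close> meets.\<close>

definition standing_before :: "'w order_book \<Rightarrow> real \<Rightarrow> 'w \<Rightarrow> nat set" where
  "standing_before X t \<omega> =
     {i \<in> orders X \<omega>. subm X i \<omega> < t \<and> t \<le> subm X i \<omega> + life X i \<omega> \<and> ereal t \<le> exec X i \<omega>}"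

definition book_count :: "'w order_book \<Rightarrow> real \<Rightarrow> real set \<Rightarrow> 'w \<Rightarrow> nat" where
  "book_count X t A \<omega> = card {i \<in> standing X t \<omega>. price X i \<omega> \<in> A}"

definition submitted :: "'w order_book \<Rightarrow> (real \<times> real) set \<Rightarrow> 'w \<Rightarrow> nat set" where
  "submitted X A \<omega> =
     {i \<in> orders X \<omega>. 0 < subm X i \<omega> \<and> (price X i \<omega>, subm X i \<omega>) \<in> A}"

definition cancelled :: "'w order_book \<Rightarrow> (real \<times> real) set \<Rightarrow> 'w \<Rightarrow> nat set" where
  "cancelled X A \<omega> =
     {i \<in> orders X \<omega>. ereal (subm X i \<omega> + life X i \<omega>) < exec X i \<omega> \<and>
        (price X i \<omega>, subm X i \<omega> + life X i \<omega>) \<in> A}"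

definition market_in :: "'w order_book \<Rightarrow> real set \<Rightarrow> 'w \<Rightarrow> real set" where
  "market_in X A \<omega> = market X \<omega> \<inter> A"

text \<open>Ties in price have probability zero for the Poisson arrivals; should they occur in the
  initial book, a market order executes exactly one of the orders at the lowest price.\<close>

definition matching_rule :: "'w order_book \<Rightarrow> 'w \<Rightarrow> bool" where
  "matching_rule X \<omega> \<longleftrightarrow>
     (\<forall>i\<in>orders X \<omega>. exec X i \<omega> \<noteq> - \<infinity> \<and>
        (\<forall>t. exec X i \<omega> = ereal t \<longrightarrow>
           t \<in> market X \<omega> \<and> i \<in> standing_before X t \<omega> \<and>
           (\<forall>j\<in>standing_before X t \<omega>. price X i \<omega> \<le> price X j \<omega>))) \<and>
     (\<forall>t\<in>market X \<omega>. standing_before X t \<omega> \<noteq> {} \<longrightarrow>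
        (\<exists>!i. i \<in> orders X \<omega> \<and> exec X i \<omega> = ereal t))"

definition limit_intensity :: "real \<Rightarrow> (real \<Rightarrow> real) \<Rightarrow> (real \<times> real) measure" where
  "limit_intensity \<alpha> hl =
     density lborel (\<lambda>(u, t). ennreal (\<alpha> * hl u) * indicator ({0..} \<times> {0<..}) (u, t))"

definition market_intensity :: "real \<Rightarrow> real measure" where
  "market_intensity \<mu> = density lborel (\<lambda>t. ennreal \<mu> * indicator {0<..} t)"

definition measurable_book :: "'w measure \<Rightarrow> 'w order_book \<Rightarrow> bool" where
  "measurable_book M X \<longleftrightarrow>
     (\<forall>i. {\<omega> \<in> space M. i \<in> orders X \<omega>} \<in> sets M \<and>
        price X i \<in> borel_measurable M \<and> subm X i \<in> borel_measurable M \<and>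
        life X i \<in> borel_measurable M \<and> exec X i \<in> borel_measurable M)"

definition book_paths :: "'w order_book \<Rightarrow> 'w \<Rightarrow> bool" where
  "book_paths X \<omega> \<longleftrightarrow>
     (\<forall>i\<in>orders X \<omega>. 0 \<le> price X i \<omega> \<and> 0 \<le> subm X i \<omega>) \<and>
     (\<forall>q t. finite {i \<in> orders X \<omega>. price X i \<omega> \<le> q \<and> subm X i \<omega> \<le> t}) \<and>
     market X \<omega> \<subseteq> {0<..} \<and> (\<forall>t. finite (market X \<omega> \<inter> {..t})) \<and>
     matching_rule X \<omega>"

text \<open>\<open>F\<close> is the history of the system: the arrivals and the book are adapted to it, and at
  each time \<open>s\<close> the past, the future limit orders and the future market orders are independent.
  Future information on lifetimes may be contained in \<open>F\<close>, since lifetimes are independent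
  of the arrivals.\<close>

definition arrivals_wrt_history ::
  "'w measure \<Rightarrow> (real \<Rightarrow> 'w measure) \<Rightarrow> 'w order_book \<Rightarrow> bool" where
  "arrivals_wrt_history M F X \<longleftrightarrow>
     filtration (space M) F \<and> (\<forall>t. subalgebra M (F t)) \<and>
     (\<forall>t\<ge>0. count_events M (submitted X) {A \<in> sets borel. A \<subseteq> UNIV \<times> {..t}} \<subseteq> sets (F t) \<and>
        count_events M (market_in X) {A \<in> sets borel. A \<subseteq> {..t}} \<subseteq> sets (F t) \<and>
        (\<forall>A\<in>sets borel. book_count X t A \<in> measurable (F t) (count_space UNIV))) \<and>
     (\<forall>s\<ge>0. prob_space.indep_sets M
        (\<lambda>j::nat. if j = 0 then sets (F s)
           else if j = 1 then sigma_sets (space M)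
             (count_events M (submitted X) {A \<in> sets borel. A \<subseteq> UNIV \<times> {s<..}})
           else sigma_sets (space M)
             (count_events M (market_in X) {A \<in> sets borel. A \<subseteq> {s<..}}))
        {0, 1, 2})"

definition exponential_lifetimes :: "'w measure \<Rightarrow> 'w order_book \<Rightarrow> real \<Rightarrow> bool" where
  "exponential_lifetimes M X \<theta> \<longleftrightarrow>
     (\<forall>i. distributed M lborel (life X i) (exponential_density \<theta>)) \<and>
     prob_space.indep_vars M (\<lambda>_. borel) (life X) UNIV \<and>
     prob_space.indep_set M
       (sigma_sets (space M) {life X i -` A \<inter> space M |i A. A \<in> sets borel})
       (sigma_sets (space M)
          ({{\<omega> \<in> space M. i \<in> orders X \<omega> \<and> (price X i \<omega>, subm X i \<omega>) \<in> A} |i A. A \<in> sets borel} \<union>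
           count_events M (market_in X) (sets borel)))"

definition one_side_book ::
  "'w measure \<Rightarrow> (real \<Rightarrow> 'w measure) \<Rightarrow> 'w order_book \<Rightarrow>
     real \<Rightarrow> (real \<Rightarrow> real) \<Rightarrow> real \<Rightarrow> real \<Rightarrow> bool" where
  "one_side_book M F X \<alpha> hl \<mu> \<theta> \<longleftrightarrow>
     prob_space M \<and> measurable_book M X \<and> (AE \<omega> in M. book_paths X \<omega>) \<and>
     poisson_process M (submitted X) (limit_intensity \<alpha> hl) \<and>
     poisson_process M (market_in X) (market_intensity \<mu>) \<and>
     arrivals_wrt_history M F X \<and> exponential_lifetimes M X \<theta>"

text \<open>The number of orders standing in \<open>{0..q}\<close> is a birth-and-death process; in the
  stationary regime its law at every time is the stationary one.\<close>

definition stationary_regime ::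
  "'w measure \<Rightarrow> 'w order_book \<Rightarrow> real \<Rightarrow> (real \<Rightarrow> real) \<Rightarrow> real \<Rightarrow> real \<Rightarrow> bool" where
  "stationary_regime M X \<alpha> hl \<mu> \<theta> \<longleftrightarrow>
     (\<forall>t\<ge>0. \<forall>q\<ge>0. distr M (count_space UNIV) (book_count X t {0..q}) =
        measure_pmf (book_law \<alpha> hl \<mu> \<theta> q))"

section \<open>Probability of cancellation\<close>

text \<open>Mean number of cancellations per unit time over mean number of submissions per unit
  time, for prices in \<open>{p..p + \<epsilon>}\<close>. In the stationary regime the choice of the
  time window \<open>{0<..1}\<close> is immaterial.\<close>

definition cancelled_fraction :: "'w measure \<Rightarrow> 'w order_book \<Rightarrow> real \<Rightarrow> real \<Rightarrow> real" where
  "cancelled_fraction M X p \<epsilon> =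
     (LINT \<omega>|M. real (card (cancelled X ({p..p + \<epsilon>} \<times> {0<..1}) \<omega>))) /
     (LINT \<omega>|M. real (card (submitted X ({p..p + \<epsilon>} \<times> {0<..1}) \<omega>)))"

definition cancel_prob :: "'w measure \<Rightarrow> 'w order_book \<Rightarrow> real \<Rightarrow> real" where
  "cancel_prob M X p = Lim (at_right 0) (cancelled_fraction M X p)"

end

theory Submission
  imports Defs
begin

text \<open>Up to time 1, the orders priced in \<open>{0..q}\<close> that enter the book are those that leave it by
  cancellation or execution or are still standing. In the stationary regime the mean number of
  standing orders does not change, so the mean number of cancellations per unit time is the
  submission rate \<open>x = limit_rate \<alpha> hl q\<close> minus the rate of executions. A market order executes an
  order priced in \<open>{0..q}\<close> exactly if it finds one; as market orders are Poisson and independent of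
  the past, these executions have rate \<open>\<mu> (1 - \<pi> 0)\<close>, where \<open>\<pi>\<close> is the stationary law of the
  number of orders standing in \<open>{0..q}\<close>. Detailed balance for \<open>\<pi>\<close> identifies
  \<open>x - \<mu> (1 - \<pi> 0)\<close> with \<open>\<theta>\<close> times the mean of \<open>\<pi>\<close>. Hence the cancelled fraction is \<open>\<theta>\<close> times a
  difference quotient of \<open>bd_mean\<close>, the mean as a function of \<open>x\<close>, and the claim is the chain rule.\<close>

section \<open>Expectations of counts\<close>

text \<open>The law of \<open>N\<close> is a density over counting measure, and for nonnegative
  terms summability is integrability. So a single series gives both existence and value of the
  mean.\<close>

lemma (in prob_space) expectation_nat_sums:
  fixes N :: "'a \<Rightarrow> nat"
  assumes N: "N \<in> measurable M (count_space UNIV)"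
    and s: "(\<lambda>k. real k * prob {\<omega> \<in> space M. N \<omega> = k}) sums s"
  shows "integrable M (\<lambda>\<omega>. real (N \<omega>))" and "expectation (\<lambda>\<omega>. real (N \<omega>)) = s"
proof -
  let ?D = "density (count_space UNIV) (\<lambda>k. ennreal (prob {\<omega> \<in> space M. N \<omega> = k}))"
  have D: "distr M (count_space UNIV) N = ?D"
  proof (rule measure_eqI_countable[where A = UNIV])
    fix k :: nat
    have "N -` {k} \<inter> space M = {\<omega> \<in> space M. N \<omega> = k}" by auto
    then show "emeasure (distr M (count_space UNIV) N) {k} = emeasure ?D {k}"
      using N by (simp add: emeasure_distr emeasure_density emeasure_eq_measure)
  qed auto
  have i: "integrable (count_space UNIV) (\<lambda>k. prob {\<omega> \<in> space M. N \<omega> = k} *\<^sub>R real k)"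
    using sums_summable[OF s] by (simp add: integrable_count_space_nat_iff mult.commute)
  have "integrable (distr M (count_space UNIV) N) real"
    unfolding D using i by (subst integrable_density) auto
  then show "integrable M (\<lambda>\<omega>. real (N \<omega>))"
    using N by (subst (asm) integrable_distr_eq) auto
  have "expectation (\<lambda>\<omega>. real (N \<omega>)) = integral\<^sup>L (distr M (count_space UNIV) N) real"
    using N by (subst integral_distr) auto
  also have "\<dots> = (LINT k|count_space UNIV. prob {\<omega> \<in> space M. N \<omega> = k} *\<^sub>R real k)"
    unfolding D by (rule integral_density) auto
  also have "\<dots> = s"
    using sums_integral_count_space_nat[OF i] s by (auto simp: mult.commute dest: sums_unique2)
  finally show "expectation (\<lambda>\<omega>. real (N \<omega>)) = s" .
qed

text \<open>The term at 0 vanishes, and shifting the index by one turns the rest into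
  \<open>m * exp (- m)\<close> times the exponential series.\<close>

lemma poisson_mean_sums:
  fixes m :: real
  shows "(\<lambda>k. real k * (m ^ k / fact k * exp (- m))) sums m"
proof -
  have "(\<lambda>k. m * exp (- m) * (m ^ k / fact k)) sums (m * exp (- m) * exp m)"
    using exp_converges[of m] by (intro sums_mult) (simp add: divide_inverse mult.commute)
  moreover have "m * exp (- m) * exp m = m" by (simp add: exp_minus field_simps)
  ultimately have "(\<lambda>k. m * exp (- m) * (m ^ k / fact k)) sums m" by simp
  moreover have "m * exp (- m) * (m ^ k / fact k) = real (Suc k) * (m ^ Suc k / fact (Suc k) * exp (- m))"
    for k by (simp add: divide_simps)
  ultimately have "(\<lambda>k. real (Suc k) * (m ^ Suc k / fact (Suc k) * exp (- m))) sums m"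
    by (simp only:)
  then show ?thesis by (subst (asm) sums_Suc_iff) simp
qed

lemma poisson_process_mean:
  assumes M: "prob_space M" and P: "poisson_process M D \<nu>"
    and A: "A \<in> sets \<nu>" "emeasure \<nu> A < \<infinity>"
  shows "integrable M (\<lambda>\<omega>. real (card (D A \<omega>)))"
    and "(LINT \<omega>|M. real (card (D A \<omega>))) = measure \<nu> A"
proof -
  interpret prob_space M by fact
  from P A have m: "(\<lambda>\<omega>. card (D A \<omega>)) \<in> measurable M (count_space UNIV)"
    and law: "prob {\<omega> \<in> space M. card (D A \<omega>) = k} = measure \<nu> A ^ k / fact k * exp (- measure \<nu> A)" for k
    unfolding poisson_process_def by blast+
  have "(\<lambda>k. real k * prob {\<omega> \<in> space M. card (D A \<omega>) = k}) sums measure \<nu> A"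
    unfolding law by (rule poisson_mean_sums)
  from expectation_nat_sums[OF m this] show "integrable M (\<lambda>\<omega>. real (card (D A \<omega>)))"
    and "(LINT \<omega>|M. real (card (D A \<omega>))) = measure \<nu> A" by auto
qed

section \<open>The stationary law of the number of standing orders\<close>

text \<open>The stationary weight of state \<open>n\<close> without its factor \<open>x ^ n\<close>:
  keeping the birth rate apart makes the normalising constant below a power series in
  \<open>x\<close>.\<close>

definition bd_weight :: "real \<Rightarrow> real \<Rightarrow> nat \<Rightarrow> real" where
  "bd_weight \<mu> \<theta> n = (\<Prod>k=1..n. 1 / (\<mu> + real k * \<theta>))"

definition bd_partition :: "real \<Rightarrow> real \<Rightarrow> real \<Rightarrow> real" where
  "bd_partition \<mu> \<theta> x = (\<Sum>n. bd_weight \<mu> \<theta> n * x ^ n)"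

text \<open>The closed form comes from summing detailed balance, with
  \<open>1 / bd_partition\<close> as the probability of an empty book. It makes differentiability in
  \<open>x\<close> immediate and matches the balance of mean flows.\<close>

definition bd_mean :: "real \<Rightarrow> real \<Rightarrow> real \<Rightarrow> real" where
  "bd_mean \<mu> \<theta> x = (x - \<mu> * (1 - 1 / bd_partition \<mu> \<theta> x)) / \<theta>"

context
  fixes \<mu> \<theta> :: real
  assumes mu: "\<mu> \<ge> 0" and theta: "\<theta> > 0"
begin

lemma death_rate_pos: "0 < \<mu> + real (Suc n) * \<theta>"
  using mu theta by (simp add: add_nonneg_pos)

lemma bd_weight_0 [simp]: "bd_weight \<mu> \<theta> 0 = 1"
  by (simp add: bd_weight_def)

lemma bd_weight_Suc: "bd_weight \<mu> \<theta> (Suc n) = bd_weight \<mu> \<theta> n / (\<mu> + real (Suc n) * \<theta>)"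
  by (simp add: bd_weight_def)

lemma bd_weight_pos: "0 < bd_weight \<mu> \<theta> n"
  by (induction n) (use death_rate_pos in \<open>simp_all add: bd_weight_Suc del: of_nat_Suc\<close>)

text \<open>The \<open>k\<close>-th death rate is at least \<open>k * \<theta>\<close>. This
  comparison with the exponential series makes the partition series converge for every real
  \<open>x\<close>.\<close>

lemma bd_weight_le: "bd_weight \<mu> \<theta> n \<le> (1 / \<theta>) ^ n / fact n"
proof (induction n)
  case (Suc n)
  have "bd_weight \<mu> \<theta> (Suc n) \<le> ((1 / \<theta>) ^ n / fact n) / (real (Suc n) * \<theta>)"
    unfolding bd_weight_Suc
    by (rule frac_le) (use Suc mu theta bd_weight_pos[of n] in auto)
  also have "\<dots> = (1 / \<theta>) ^ Suc n / fact (Suc n)"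
    using theta by (simp add: field_simps)
  finally show ?case .
qed simp

lemma summable_bd_weight: "summable (\<lambda>n. bd_weight \<mu> \<theta> n * x ^ n)"
proof (rule summable_comparison_test')
  show "summable (\<lambda>n. inverse (fact n) * (\<bar>x\<bar> / \<theta>) ^ n)"
    by (rule summable_exp)
  show "norm (bd_weight \<mu> \<theta> n * x ^ n) \<le> inverse (fact n) * (\<bar>x\<bar> / \<theta>) ^ n" if "n \<ge> 0" for n
  proof -
    have "norm (bd_weight \<mu> \<theta> n * x ^ n) = bd_weight \<mu> \<theta> n * \<bar>x\<bar> ^ n"
      using bd_weight_pos[of n] by (simp add: abs_mult power_abs)
    also have "\<dots> \<le> (1 / \<theta>) ^ n / fact n * \<bar>x\<bar> ^ n"
      by (intro mult_right_mono bd_weight_le) auto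
    finally show ?thesis by (simp add: field_simps)
  qed
qed

lemma bd_partition_differentiable: "bd_partition \<mu> \<theta> field_differentiable at x"
proof -
  have "((\<lambda>x. \<Sum>n. bd_weight \<mu> \<theta> n * x ^ n) has_field_derivative
      (\<Sum>n. diffs (bd_weight \<mu> \<theta>) n * x ^ n)) (at x)"
    by (rule termdiffs_strong_converges_everywhere) (rule summable_bd_weight)
  then show ?thesis
    unfolding bd_partition_def field_differentiable_def by blast
qed

lemma bd_partition_pos:
  assumes "x \<ge> 0" shows "0 < bd_partition \<mu> \<theta> x"
  unfolding bd_partition_def
  by (rule suminf_pos2[OF summable_bd_weight, of _ 0])
    (use assms bd_weight_pos in \<open>auto simp: less_imp_le\<close>)

text \<open>The derivative is two-sided even at \<open>x = 0\<close>, since the partition function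
  is an everywhere convergent power series and is positive for \<open>x \<ge> 0\<close>.\<close>

lemma bd_mean_differentiable:
  assumes "x \<ge> 0" shows "bd_mean \<mu> \<theta> field_differentiable at x"
proof -
  have "(\<lambda>x. (x - \<mu> * (1 - 1 / bd_partition \<mu> \<theta> x)) / \<theta>) field_differentiable at x"
    using bd_partition_pos[OF assms] theta
    by (intro derivative_intros bd_partition_differentiable) auto
  then show ?thesis unfolding bd_mean_def[abs_def] .
qed

lemma bd_mean_0: "bd_mean \<mu> \<theta> 0 = 0"
  by (simp add: bd_mean_def bd_partition_def powser_zero)

section \<open>Detailed balance, existence and uniqueness of the stationary law\<close>

lemma stationary_detailed_balance:
  assumes st: "stationary_distribution (birth_death_rate (\<lambda>_. x) (\<lambda>n. \<mu> + real n * \<theta>)) \<pi>"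
  shows "pmf \<pi> (Suc n) * (\<mu> + real (Suc n) * \<theta>) = pmf \<pi> n * x"
proof -
  let ?Q = "birth_death_rate (\<lambda>_. x) (\<lambda>n. \<mu> + real n * \<theta>)"
  \<comment> \<open>Column \<open>j\<close> of the rate matrix vanishes beyond row
    \<open>Suc j\<close>. Column 0 says that no net flow crosses from 0 to 1; each later column
    passes this on to the next pair of states.\<close>
  have col: "(\<Sum>i\<in>{..Suc j}. pmf \<pi> i * ?Q i j) = 0" for j
  proof -
    have "(\<lambda>i. pmf \<pi> i * ?Q i j) sums (\<Sum>i\<in>{..Suc j}. pmf \<pi> i * ?Q i j)"
      by (rule sums_finite) (auto simp: birth_death_rate_def)
    moreover have "(\<lambda>i. pmf \<pi> i * ?Q i j) sums 0"
      using st unfolding stationary_distribution_def by blast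
    ultimately show ?thesis by (rule sums_unique2)
  qed
  show ?thesis
  proof (induction n)
    case 0
    show ?case using col[of 0] by (simp add: birth_death_rate_def atMost_Suc algebra_simps)
  next
    case (Suc n)
    have "(\<Sum>i\<in>{..Suc (Suc n)}. pmf \<pi> i * ?Q i (Suc n)) =
      (\<Sum>i\<in>{n, Suc n, Suc (Suc n)}. pmf \<pi> i * ?Q i (Suc n))"
      by (rule sum.mono_neutral_right) (auto simp: birth_death_rate_def)
    from trans[OF this[symmetric] col] Suc.IH show ?case
      by (simp add: birth_death_rate_def algebra_simps)
  qed
qed

text \<open>Detailed balance is a first-order recursion, so it fixes the law up to
  \<open>pmf \<pi> 0\<close>, which total mass 1 then determines. Uniqueness of the stationary law
  follows.\<close>

lemma stationary_pmf:
  assumes x: "x \<ge> 0"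
    and st: "stationary_distribution (birth_death_rate (\<lambda>_. x) (\<lambda>n. \<mu> + real n * \<theta>)) \<pi>"
  shows "pmf \<pi> n = bd_weight \<mu> \<theta> n * x ^ n / bd_partition \<mu> \<theta> x"
proof -
  have eq: "pmf \<pi> n = pmf \<pi> 0 * (bd_weight \<mu> \<theta> n * x ^ n)" for n
  proof (induction n)
    case (Suc n)
    from stationary_detailed_balance[OF st, of n] death_rate_pos[of n]
    have "pmf \<pi> (Suc n) = pmf \<pi> n * x / (\<mu> + real (Suc n) * \<theta>)"
      by (simp add: eq_divide_eq del: of_nat_Suc)
    with Suc show ?case by (simp add: bd_weight_Suc mult_ac)
  qed simp
  have "integrable (count_space UNIV) (pmf \<pi>)" by (rule integrable_pmf)
  from sums_integral_count_space_nat[OF this] have "pmf \<pi> sums 1"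
    by (simp add: integral_pmf)
  moreover have "(\<lambda>n. pmf \<pi> 0 * (bd_weight \<mu> \<theta> n * x ^ n)) sums (pmf \<pi> 0 * bd_partition \<mu> \<theta> x)"
    unfolding bd_partition_def by (intro sums_mult summable_sums summable_bd_weight)
  then have "pmf \<pi> sums (pmf \<pi> 0 * bd_partition \<mu> \<theta> x)" by (simp flip: eq)
  ultimately have "pmf \<pi> 0 * bd_partition \<mu> \<theta> x = 1" by (metis sums_unique2)
  with bd_partition_pos[OF x] have "pmf \<pi> 0 = 1 / bd_partition \<mu> \<theta> x"
    by (simp add: field_simps)
  with eq[of n] show ?thesis by simp
qed

text \<open>The normalised weights satisfy detailed balance, and then the terms of every column
  cancel.\<close>

lemma stationary_distribution_exists:
  assumes x: "x \<ge> 0"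
  shows "\<exists>\<pi>. stationary_distribution (birth_death_rate (\<lambda>_. x) (\<lambda>n. \<mu> + real n * \<theta>)) \<pi>"
proof -
  let ?w = "\<lambda>n. bd_weight \<mu> \<theta> n * x ^ n / bd_partition \<mu> \<theta> x"
  let ?Q = "birth_death_rate (\<lambda>_. x) (\<lambda>n. \<mu> + real n * \<theta>)"
  have nonneg: "?w n \<ge> 0" for n
    using bd_weight_pos[of n] bd_partition_pos[OF x] x by (simp add: less_imp_le)
  have "?w sums (bd_partition \<mu> \<theta> x / bd_partition \<mu> \<theta> x)"
    unfolding bd_partition_def by (intro sums_divide summable_sums summable_bd_weight)
  then have "?w sums 1" using bd_partition_pos[OF x] by simp
  then have one: "(\<integral>\<^sup>+n. ennreal (?w n) \<partial>count_space UNIV) = 1"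
    using nonneg by (simp add: nn_integral_count_space_nat suminf_ennreal_eq sums_iff)
  define \<pi> where "\<pi> = embed_pmf ?w"
  have pmf: "pmf \<pi> n = ?w n" for n
    unfolding \<pi>_def using nonneg one by (intro pmf_embed_pmf) auto
  have bal: "pmf \<pi> (Suc n) * (\<mu> + real (Suc n) * \<theta>) = pmf \<pi> n * x" for n
    unfolding pmf using death_rate_pos[of n] by (simp add: bd_weight_Suc del: of_nat_Suc)
  have "(\<lambda>i. pmf \<pi> i * ?Q i j) sums 0" for j
  proof -
    have "(\<lambda>i. pmf \<pi> i * ?Q i j) sums (\<Sum>i\<in>{..Suc j}. pmf \<pi> i * ?Q i j)"
      by (rule sums_finite) (auto simp: birth_death_rate_def)
    also have "(\<Sum>i\<in>{..Suc j}. pmf \<pi> i * ?Q i j) = 0"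
    proof (cases j)
      case 0
      show ?thesis unfolding 0 using bal[of 0]
        by (simp add: birth_death_rate_def atMost_Suc algebra_simps)
    next
      case (Suc n)
      have "(\<Sum>i\<in>{..Suc (Suc n)}. pmf \<pi> i * ?Q i (Suc n)) =
        (\<Sum>i\<in>{n, Suc n, Suc (Suc n)}. pmf \<pi> i * ?Q i (Suc n))"
        by (rule sum.mono_neutral_right) (auto simp: birth_death_rate_def)
      also have "\<dots> = 0"
        using bal[of n] bal[of "Suc n"] by (simp add: birth_death_rate_def algebra_simps)
      finally show ?thesis using Suc by simp
    qed
    finally show ?thesis .
  qed
  then show ?thesis unfolding stationary_distribution_def by blast
qed

text \<open>\<open>book_law\<close> is a definite description, so existence and uniqueness are
  needed before anything can be said about it.\<close>

lemma stationary_distribution_book_law: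
  assumes x: "limit_rate \<alpha> hl q \<ge> 0"
  shows "stationary_distribution
    (birth_death_rate (\<lambda>_. limit_rate \<alpha> hl q) (\<lambda>n. \<mu> + real n * \<theta>)) (book_law \<alpha> hl \<mu> \<theta> q)"
  unfolding book_law_def
proof (rule theI', rule ex_ex1I[OF stationary_distribution_exists[OF x]])
  fix \<pi> \<pi>'
  assume st: "stationary_distribution
      (birth_death_rate (\<lambda>_. limit_rate \<alpha> hl q) (\<lambda>n. \<mu> + real n * \<theta>)) \<pi>"
    "stationary_distribution
      (birth_death_rate (\<lambda>_. limit_rate \<alpha> hl q) (\<lambda>n. \<mu> + real n * \<theta>)) \<pi>'"
  show "\<pi> = \<pi>'"
    by (rule pmf_eqI) (simp only: stationary_pmf[OF x st(1)] stationary_pmf[OF x st(2)])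
qed

lemma pmf_book_law_0:
  assumes x: "limit_rate \<alpha> hl q \<ge> 0"
  shows "pmf (book_law \<alpha> hl \<mu> \<theta> q) 0 = 1 / bd_partition \<mu> \<theta> (limit_rate \<alpha> hl q)"
  by (simp add: stationary_pmf[OF x stationary_distribution_book_law[OF x]])

text \<open>Detailed balance writes \<open>real (Suc n) * pmf \<pi> (Suc n)\<close> as a combination
  of \<open>pmf \<pi> n\<close> and \<open>pmf \<pi> (Suc n)\<close>. Summing over \<open>n\<close>
  uses total mass only, so finiteness of the mean comes with its value.\<close>

lemma book_law_mean:
  assumes x: "limit_rate \<alpha> hl q \<ge> 0"
  shows "integrable (book_law \<alpha> hl \<mu> \<theta> q) real"
    and "measure_pmf.expectation (book_law \<alpha> hl \<mu> \<theta> q) real = bd_mean \<mu> \<theta> (limit_rate \<alpha> hl q)"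
proof -
  let ?x = "limit_rate \<alpha> hl q" and ?\<pi> = "book_law \<alpha> hl \<mu> \<theta> q"
  have "integrable (count_space UNIV) (pmf ?\<pi>)" by (rule integrable_pmf)
  from sums_integral_count_space_nat[OF this] have one: "pmf ?\<pi> sums 1"
    by (simp add: integral_pmf)
  then have "(\<lambda>n. pmf ?\<pi> (Suc n)) sums (1 - pmf ?\<pi> 0)"
    by (subst sums_Suc_iff) simp
  with one have "(\<lambda>n. (?x * pmf ?\<pi> n - \<mu> * pmf ?\<pi> (Suc n)) / \<theta>) sums
      ((?x * 1 - \<mu> * (1 - pmf ?\<pi> 0)) / \<theta>)"
    by (intro sums_divide sums_diff sums_mult)
  moreover have "(?x * pmf ?\<pi> n - \<mu> * pmf ?\<pi> (Suc n)) / \<theta> = real (Suc n) * pmf ?\<pi> (Suc n)" for n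
    using stationary_detailed_balance[OF stationary_distribution_book_law[OF x], of n] theta
    by (simp add: field_simps)
  ultimately have "(\<lambda>n. real (Suc n) * pmf ?\<pi> (Suc n)) sums bd_mean \<mu> \<theta> ?x"
    by (simp add: bd_mean_def pmf_book_law_0[OF x])
  then have "(\<lambda>n. real n * pmf ?\<pi> n) sums bd_mean \<mu> \<theta> ?x"
    by (subst (asm) sums_Suc_iff) simp
  then have s: "(\<lambda>n. real n * measure ?\<pi> {k \<in> space ?\<pi>. k = n}) sums bd_mean \<mu> \<theta> ?x"
    by (simp add: pmf.rep_eq)
  from measure_pmf.expectation_nat_sums[of "\<lambda>k. k", OF _ s]
  show "integrable ?\<pi> real" and "measure_pmf.expectation ?\<pi> real = bd_mean \<mu> \<theta> ?x" by auto
qed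

end

section \<open>Sample paths of the book\<close>

definition executed :: "'w order_book \<Rightarrow> (real \<times> real) set \<Rightarrow> 'w \<Rightarrow> nat set" where
  "executed X A \<omega> = {i \<in> orders X \<omega>. \<exists>t. exec X i \<omega> = ereal t \<and> (price X i \<omega>, t) \<in> A}"

context
  fixes X :: "'w order_book" and \<omega> :: 'w
  assumes paths: "book_paths X \<omega>"
begin

lemma finite_submitted_before: "finite {i \<in> orders X \<omega>. price X i \<omega> \<le> q \<and> subm X i \<omega> \<le> t}"
  using paths by (simp add: book_paths_def)

lemma exec_cases:
  assumes "i \<in> orders X \<omega>"
  obtains "exec X i \<omega> = \<infinity>"
  | t where "exec X i \<omega> = ereal t" "t \<in> market X \<omega>" "0 < t" "subm X i \<omega> < t"
      "t \<le> subm X i \<omega> + life X i \<omega>"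
      "\<forall>j\<in>standing_before X t \<omega>. price X i \<omega> \<le> price X j \<omega>"
proof (cases "exec X i \<omega>")
  case (real t)
  then have "t \<in> market X \<omega>" "i \<in> standing_before X t \<omega>"
    "\<forall>j\<in>standing_before X t \<omega>. price X i \<omega> \<le> price X j \<omega>"
    using paths assms unfolding book_paths_def matching_rule_def by blast+
  with real paths that(2) show ?thesis
    by (force simp: standing_before_def book_paths_def)
next
  case MInf
  with paths assms show ?thesis unfolding book_paths_def matching_rule_def by blast
qed (use that in blast)

text \<open>With positive lifetimes, an order cancelled by time \<open>T\<close> was submitted by
  time \<open>T\<close>, and only finitely many such orders have a bounded price.\<close>

lemma finite_cancelled:
  assumes life: "\<And>i. 0 < life X i \<omega>" and A: "A \<subseteq> {..q}"
  shows "finite (cancelled X (A \<times> {0<..T}) \<omega>)"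
proof (rule finite_subset[OF _ finite_submitted_before[of q T]])
  have "subm X i \<omega> \<le> T" if "subm X i \<omega> + life X i \<omega> \<le> T" for i
    using that life[of i] by linarith
  then show "cancelled X (A \<times> {0<..T}) \<omega> \<subseteq> {i \<in> orders X \<omega>. price X i \<omega> \<le> q \<and> subm X i \<omega> \<le> T}"
    using A by (auto simp: cancelled_def)
qed

text \<open>Both sides count the orders with price in \<open>A\<close> submitted by time
  \<open>T\<close>: once by how they entered, once by their fate at time \<open>T\<close>.\<close>

lemma flow_conservation:
  assumes life: "\<And>i. 0 < life X i \<omega>" and A: "A \<subseteq> {..q}" and T: "0 \<le> T"
  shows "book_count X 0 A \<omega> + card (submitted X (A \<times> {0<..T}) \<omega>) =
    book_count X T A \<omega> + card (cancelled X (A \<times> {0<..T}) \<omega>) + card (executed X (A \<times> {0<..T}) \<omega>)"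
proof -
  let ?U = "{i \<in> orders X \<omega>. price X i \<omega> \<in> A \<and> subm X i \<omega> \<le> T}"
  let ?S = "\<lambda>t. {i \<in> standing X t \<omega>. price X i \<omega> \<in> A}"
  let ?N = "submitted X (A \<times> {0<..T}) \<omega>" and ?C = "cancelled X (A \<times> {0<..T}) \<omega>"
    and ?E = "executed X (A \<times> {0<..T}) \<omega>"
  have fin: "finite ?U"
    by (rule finite_subset[OF _ finite_submitted_before[of q T]]) (use A in auto)
  have subm_nonneg: "0 \<le> subm X i \<omega>" if "i \<in> orders X \<omega>" for i
    using paths that by (auto simp: book_paths_def)
  \<comment> \<open>An order with submission time 0 stands at time 0, because its lifetime is
    positive and executions happen at market times, which are positive.\<close>
  have U1: "?U = ?S 0 \<union> ?N"
  proof (intro set_eqI iffI)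
    fix i assume i: "i \<in> ?U"
    then have o: "i \<in> orders X \<omega>" by simp
    show "i \<in> ?S 0 \<union> ?N"
      using i subm_nonneg[OF o] life[of i]
      by (cases rule: exec_cases[OF o]) (auto simp: standing_def submitted_def)
  qed (use T in \<open>auto simp: standing_def submitted_def\<close>)
  have D1: "?S 0 \<inter> ?N = {}" by (auto simp: standing_def submitted_def)
  \<comment> \<open>An order with a finite execution time is never cancelled: that time is at most
    its expiry, and a tie of the two counts as execution.\<close>
  have U2: "?U = ?S T \<union> ?C \<union> ?E"
  proof (intro set_eqI iffI)
    fix i assume i: "i \<in> ?U"
    then have o: "i \<in> orders X \<omega>" by simp
    show "i \<in> ?S T \<union> ?C \<union> ?E"
      using i subm_nonneg[OF o] life[of i]
      by (cases rule: exec_cases[OF o]) (auto simp: standing_def cancelled_def executed_def)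
  next
    fix i assume i: "i \<in> ?S T \<union> ?C \<union> ?E"
    then have o: "i \<in> orders X \<omega>"
      by (auto simp: standing_def cancelled_def executed_def)
    show "i \<in> ?U"
      using i life[of i]
      by (cases rule: exec_cases[OF o]) (auto simp: standing_def cancelled_def executed_def)
  qed
  have D2: "?S T \<inter> ?C = {}" by (auto simp: standing_def cancelled_def)
  have D3: "(?S T \<union> ?C) \<inter> ?E = {}"
  proof (rule ccontr)
    assume "(?S T \<union> ?C) \<inter> ?E \<noteq> {}"
    then obtain i where i: "i \<in> ?S T \<union> ?C" "i \<in> ?E" by blast
    then have o: "i \<in> orders X \<omega>" by (simp add: executed_def)
    show False
      using i by (cases rule: exec_cases[OF o]) (auto simp: standing_def cancelled_def executed_def)
  qed
  have "finite (?S 0)" "finite ?N" using fin unfolding U1 by simp_all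
  then have "card ?U = card (?S 0) + card ?N"
    unfolding U1 using D1 by (intro card_Un_disjoint)
  moreover have "finite (?S T)" "finite ?C" "finite ?E" using fin unfolding U2 by simp_all
  then have "card ?U = card (?S T) + card ?C + card ?E"
    unfolding U2 using D2 D3 by (simp add: card_Un_disjoint)
  ultimately show ?thesis by (simp add: book_count_def)
qed

text \<open>Execution times biject executed orders with successful market orders. Price priority
  enters here: a market order that finds a price up to \<open>q\<close> executes the lowest price,
  hence one in \<open>{0..q}\<close>. The price range must therefore start at 0.\<close>

lemma card_executed:
  "card (executed X ({0..q} \<times> {0<..T}) \<omega>) =
    card {t \<in> market X \<omega> \<inter> {0<..T}. \<exists>i\<in>standing_before X t \<omega>. price X i \<omega> \<le> q}"
proof (rule bij_betw_same_card[of "\<lambda>i. real_of_ereal (exec X i \<omega>)"], rule bij_betw_imageI)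
  let ?E = "executed X ({0..q} \<times> {0<..T}) \<omega>"
  let ?R = "{t \<in> market X \<omega> \<inter> {0<..T}. \<exists>i\<in>standing_before X t \<omega>. price X i \<omega> \<le> q}"
  have unique: "\<exists>!i. i \<in> orders X \<omega> \<and> exec X i \<omega> = ereal t"
    if "t \<in> market X \<omega>" "standing_before X t \<omega> \<noteq> {}" for t
    using paths that unfolding book_paths_def matching_rule_def by blast
  have before: "t \<in> market X \<omega> \<and> i \<in> standing_before X t \<omega> \<and>
      (\<forall>j\<in>standing_before X t \<omega>. price X i \<omega> \<le> price X j \<omega>)"
    if "i \<in> orders X \<omega>" "exec X i \<omega> = ereal t" for i t
    using paths that unfolding book_paths_def matching_rule_def by blast
  show "inj_on (\<lambda>i. real_of_ereal (exec X i \<omega>)) ?E"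
  proof (rule inj_onI)
    fix i j assume i: "i \<in> ?E" and j: "j \<in> ?E"
      and eq: "real_of_ereal (exec X i \<omega>) = real_of_ereal (exec X j \<omega>)"
    then obtain t where t: "exec X i \<omega> = ereal t" "exec X j \<omega> = ereal t"
      and o: "i \<in> orders X \<omega>" "j \<in> orders X \<omega>"
      by (auto simp: executed_def)
    with unique[of t] before[of i t] show "i = j" by auto
  qed
  show "(\<lambda>i. real_of_ereal (exec X i \<omega>)) ` ?E = ?R"
  proof (intro set_eqI iffI)
    fix t assume "t \<in> (\<lambda>i. real_of_ereal (exec X i \<omega>)) ` ?E"
    then obtain i where i: "i \<in> orders X \<omega>" "exec X i \<omega> = ereal t" "price X i \<omega> \<le> q" "0 < t" "t \<le> T"
      by (auto simp: executed_def)
    with before[OF i(1,2)] show "t \<in> ?R" by auto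
  next
    fix t assume t: "t \<in> ?R"
    then obtain j where j: "j \<in> standing_before X t \<omega>" "price X j \<omega> \<le> q" by blast
    with t unique[of t] obtain i where i: "i \<in> orders X \<omega>" "exec X i \<omega> = ereal t" by auto
    from before[OF i] j have "price X i \<omega> \<le> q" by fastforce
    moreover have "0 \<le> price X i \<omega>" using paths i by (auto simp: book_paths_def)
    ultimately have "i \<in> ?E" using i t by (simp add: executed_def)
    with i show "t \<in> (\<lambda>i. real_of_ereal (exec X i \<omega>)) ` ?E" by force
  qed
qed

text \<open>The inequalities in \<open>standing_before\<close> are chosen so that it is the left
  limit of \<open>standing\<close>. An order outside it is not yet submitted, has expired, or has
  been executed strictly earlier; each of these is stable just before \<open>t\<close>.\<close>

lemma standing_left_limit:
  assumes i: "i \<in> orders X \<omega>"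
  shows "eventually (\<lambda>s. i \<in> standing X s \<omega> \<longleftrightarrow> i \<in> standing_before X t \<omega>) (at_left t)"
proof -
  have left: "eventually (\<lambda>s. s \<in> {b<..<t}) (at_left t)" if "b < t" for b
    using that by (rule eventually_at_left_real)
  consider "i \<in> standing_before X t \<omega>" | "t \<le> subm X i \<omega>"
    | "subm X i \<omega> + life X i \<omega> < t" | "exec X i \<omega> < ereal t"
    using i by (force simp: standing_before_def)
  then show ?thesis
  proof cases
    case 1
    then have "subm X i \<omega> < t" by (simp add: standing_before_def)
    from left[OF this] show ?thesis
    proof eventually_elim
      case (elim s)
      have "ereal s < exec X i \<omega>"
        using 1 elim by (auto simp: standing_before_def intro: less_le_trans[of _ "ereal t"])
      with 1 elim show ?case by (auto simp: standing_before_def standing_def)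
    qed
  next
    case 2
    with left[of "t - 1"] show ?thesis
      by (auto simp: standing_before_def standing_def elim!: eventually_mono)
  next
    case 3
    from left[OF this] 3 show ?thesis
      by (auto simp: standing_before_def standing_def elim!: eventually_mono)
  next
    case 4
    show ?thesis
    proof (cases rule: exec_cases[OF i])
      case (2 e)
      with 4 left[of e] show ?thesis
        by (auto simp: standing_before_def standing_def elim!: eventually_mono)
    qed (use 4 in auto)
  qed
qed

text \<open>Only finitely many orders matter, so their individual left limits hold at a common time
  close to \<open>t\<close>.\<close>

lemma book_count_left_limit:
  "eventually (\<lambda>s. book_count X s {0..q} \<omega> \<noteq> 0 \<longleftrightarrow>
     (\<exists>i\<in>standing_before X t \<omega>. price X i \<omega> \<le> q)) (at_left t)"
proof -
  let ?U = "{i \<in> orders X \<omega>. price X i \<omega> \<le> q \<and> subm X i \<omega> \<le> t}"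
  have "eventually (\<lambda>s. \<forall>i\<in>?U. i \<in> standing X s \<omega> \<longleftrightarrow> i \<in> standing_before X t \<omega>) (at_left t)"
    by (intro eventually_ball_finite finite_submitted_before ballI standing_left_limit) auto
  moreover have "eventually (\<lambda>s. s \<in> {t - 1<..<t}) (at_left t)"
    by (rule eventually_at_left_real) simp
  ultimately show ?thesis
  proof eventually_elim
    case (elim s)
    let ?S = "{i \<in> standing X s \<omega>. price X i \<omega> \<in> {0..q}}"
    have nonneg: "0 \<le> price X i \<omega>" if "i \<in> orders X \<omega>" for i
      using paths that by (auto simp: book_paths_def)
    have "?S \<subseteq> ?U" using elim by (auto simp: standing_def)
    then have "finite ?S" by (rule finite_subset) (rule finite_submitted_before)
    then have "book_count X s {0..q} \<omega> \<noteq> 0 \<longleftrightarrow> ?S \<noteq> {}" by (simp add: book_count_def)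
    also have "\<dots> \<longleftrightarrow> (\<exists>i\<in>?U. i \<in> standing X s \<omega>)"
      using elim nonneg by (fastforce simp: standing_def)
    also have "\<dots> \<longleftrightarrow> (\<exists>i\<in>?U. i \<in> standing_before X t \<omega>)" using elim by blast
    also have "\<dots> \<longleftrightarrow> (\<exists>i\<in>standing_before X t \<omega>. price X i \<omega> \<le> q)"
      by (auto simp: standing_before_def)
    finally show ?case .
  qed
qed

end

section \<open>Approximating the executions on a time grid\<close>

definition grid_cell :: "nat \<Rightarrow> nat \<Rightarrow> real set" where
  "grid_cell n k = {real k / real (Suc n)<..real (Suc k) / real (Suc n)}"

lemma grid_cell_subset:
  assumes "k < Suc n" shows "grid_cell n k \<subseteq> {0<..1}"
proof
  fix t assume t: "t \<in> grid_cell n k"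
  have "0 \<le> real k / real (Suc n)" by simp
  also have "\<dots> < t" using t by (simp add: grid_cell_def)
  finally have "0 < t" .
  have "t \<le> real (Suc k) / real (Suc n)" using t by (simp add: grid_cell_def)
  also have "\<dots> \<le> 1" using assms by simp
  finally have "t \<le> 1" .
  with \<open>0 < t\<close> show "t \<in> {0<..1}" by simp
qed

lemma grid_cell_iff:
  assumes "0 < t"
  shows "t \<in> grid_cell n k \<longleftrightarrow> k = nat (\<lceil>t * real (Suc n)\<rceil> - 1)"
proof -
  have "t \<in> grid_cell n k \<longleftrightarrow> real k < t * real (Suc n) \<and> t * real (Suc n) \<le> real k + 1"
    by (simp add: grid_cell_def divide_simps add.commute)
  also have "\<dots> \<longleftrightarrow> \<lceil>t * real (Suc n)\<rceil> = int k + 1"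
    by (simp only: ceiling_eq_iff) auto
  also have "\<dots> \<longleftrightarrow> k = nat (\<lceil>t * real (Suc n)\<rceil> - 1)"
  proof -
    have "0 < \<lceil>t * real (Suc n)\<rceil>" using assms by (simp add: zero_less_ceiling del: of_nat_Suc)
    then show ?thesis by auto
  qed
  finally show ?thesis .
qed

text \<open>The left-open cells partition \<open>{0<..1}\<close>, so a sum over cells weighted by
  membership of \<open>t\<close> reduces to the value at the cell of \<open>t\<close>.\<close>

lemma sum_grid_cells:
  fixes t :: real
  assumes t: "t \<in> {0<..1}"
  obtains k where "k < Suc n" "t \<in> grid_cell n k"
    "\<And>f. (\<Sum>k<Suc n. f k * of_bool (t \<in> grid_cell n k)) = (f k :: real)"
proof -
  define k where "k = nat (\<lceil>t * real (Suc n)\<rceil> - 1)"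
  have iff: "t \<in> grid_cell n j \<longleftrightarrow> j = k" for j
    using grid_cell_iff[of t n j] t by (simp add: k_def)
  have "t * real (Suc n) \<le> real (Suc n)" using t by (simp add: mult_left_le_one_le)
  then have "\<lceil>t * real (Suc n)\<rceil> \<le> int (Suc n)"
    by (simp only: ceiling_le_iff of_int_of_nat_eq)
  then have k: "k < Suc n" unfolding k_def by linarith
  have "(\<Sum>j<Suc n. f j * of_bool (t \<in> grid_cell n j)) = f k" for f :: "nat \<Rightarrow> real"
    unfolding iff using k by (simp add: of_bool_def if_distrib sum.delta' del: sum.lessThan_Suc cong: if_cong)
  with k iff show ?thesis by (intro that) auto
qed

text \<open>The book is inspected at the left end of each cell, strictly before the market orders of
  that cell, so that the two factors are independent. Changes of the book within a cell are ignored;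
  the error disappears as the grid is refined.\<close>

definition discretised_executions :: "'w order_book \<Rightarrow> real \<Rightarrow> nat \<Rightarrow> 'w \<Rightarrow> real" where
  "discretised_executions X q n \<omega> =
    (\<Sum>k<Suc n. of_bool (book_count X (real k / real (Suc n)) {0..q} \<omega> \<noteq> 0) *
      real (card (market_in X (grid_cell n k) \<omega>)))"

context
  fixes X :: "'w order_book" and \<omega> :: 'w
  assumes paths: "book_paths X \<omega>"
begin

text \<open>Exchanging the sums lists the contributions by market order, the form used for both the
  bound and the limit.\<close>

lemma discretised_executions_eq:
  "discretised_executions X q n \<omega> =
    (\<Sum>t\<in>market X \<omega> \<inter> {0<..1}. \<Sum>k<Suc n.
      of_bool (book_count X (real k / real (Suc n)) {0..q} \<omega> \<noteq> 0) * of_bool (t \<in> grid_cell n k))"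
proof -
  have fin: "finite (market X \<omega> \<inter> {0<..1})"
    using paths by (rule_tac finite_subset[of _ "market X \<omega> \<inter> {..1}"]) (auto simp: book_paths_def)
  have "real (card (market_in X (grid_cell n k) \<omega>)) =
      (\<Sum>t\<in>market X \<omega> \<inter> {0<..1}. of_bool (t \<in> grid_cell n k))" if "k < Suc n" for k
  proof -
    have "market_in X (grid_cell n k) \<omega> = {t \<in> market X \<omega> \<inter> {0<..1}. t \<in> grid_cell n k}"
      using grid_cell_subset[OF that] by (auto simp: market_in_def)
    then show ?thesis using fin by (simp add: of_bool_def sum.If_cases Int_def)
  qed
  then have "discretised_executions X q n \<omega> =
    (\<Sum>k<Suc n. of_bool (book_count X (real k / real (Suc n)) {0..q} \<omega> \<noteq> 0) *
      (\<Sum>t\<in>market X \<omega> \<inter> {0<..1}. of_bool (t \<in> grid_cell n k)))"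
    unfolding discretised_executions_def by (intro sum.cong) auto
  also have "\<dots> = (\<Sum>t\<in>market X \<omega> \<inter> {0<..1}. \<Sum>k<Suc n.
      of_bool (book_count X (real k / real (Suc n)) {0..q} \<omega> \<noteq> 0) * of_bool (t \<in> grid_cell n k))"
    unfolding sum_distrib_left by (rule sum.swap)
  finally show ?thesis .
qed

lemma discretised_executions_bounds:
  "0 \<le> discretised_executions X q n \<omega>"
  "discretised_executions X q n \<omega> \<le> real (card (market_in X {0<..1} \<omega>))"
proof -
  show "0 \<le> discretised_executions X q n \<omega>"
    unfolding discretised_executions_def by (intro sum_nonneg) auto
  have "discretised_executions X q n \<omega> \<le> (\<Sum>t\<in>market X \<omega> \<inter> {0<..1}. 1)"
    unfolding discretised_executions_eq
  proof (rule sum_mono)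
    fix t assume "t \<in> market X \<omega> \<inter> {0<..1}"
    then obtain k where "(\<Sum>k<Suc n. f k * of_bool (t \<in> grid_cell n k)) = (f k :: real)" for f
      using sum_grid_cells[of t n] by auto
    from this[of "\<lambda>k. of_bool (book_count X (real k / real (Suc n)) {0..q} \<omega> \<noteq> 0)"]
    show "(\<Sum>k<Suc n. of_bool (book_count X (real k / real (Suc n)) {0..q} \<omega> \<noteq> 0) *
        of_bool (t \<in> grid_cell n k)) \<le> (1::real)"
      by simp
  qed
  then show "discretised_executions X q n \<omega> \<le> real (card (market_in X {0<..1} \<omega>))"
    by (simp add: market_in_def)
qed

text \<open>For each of the finitely many market orders, the left end of its cell approaches it from
  strictly below, so the inspected book eventually agrees with the left limit that the order
  meets.\<close>

lemma discretised_executions_tendsto: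
  "(\<lambda>n. discretised_executions X q n \<omega>) \<longlonglongrightarrow> real (card (executed X ({0..q} \<times> {0<..1}) \<omega>))"
proof -
  let ?P = "\<lambda>t. \<exists>i\<in>standing_before X t \<omega>. price X i \<omega> \<le> q"
  have fin: "finite (market X \<omega> \<inter> {0<..1})"
    using paths by (rule_tac finite_subset[of _ "market X \<omega> \<inter> {..1}"]) (auto simp: book_paths_def)
  have lim: "(\<lambda>n. \<Sum>k<Suc n. of_bool (book_count X (real k / real (Suc n)) {0..q} \<omega> \<noteq> 0) *
      of_bool (t \<in> grid_cell n k)) \<longlonglongrightarrow> (of_bool (?P t) :: real)"
    if t: "t \<in> market X \<omega> \<inter> {0<..1}" for t
  proof -
    obtain b where b: "b < t" "\<And>s. b < s \<Longrightarrow> s < t \<Longrightarrow> book_count X s {0..q} \<omega> \<noteq> 0 \<longleftrightarrow> ?P t"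
      using book_count_left_limit[OF paths, of q t] unfolding eventually_at_left_field by blast
    have "(\<lambda>n. inverse (real (Suc n))) \<longlonglongrightarrow> 0" by (rule LIMSEQ_inverse_real_of_nat)
    \<comment> \<open>Once the cells are shorter than \<open>t - b\<close>, the left end of the cell
      of \<open>t\<close> lies between \<open>b\<close> and \<open>t\<close>.\<close>
    then have "eventually (\<lambda>n. inverse (real (Suc n)) < t - b) sequentially"
      using b(1) by (intro order_tendstoD(2)) auto
    then have "eventually (\<lambda>n. (\<Sum>k<Suc n. of_bool (book_count X (real k / real (Suc n)) {0..q} \<omega> \<noteq> 0) *
      of_bool (t \<in> grid_cell n k)) = (of_bool (?P t) :: real)) sequentially"
    proof eventually_elim
      case (elim n)
      obtain k where k: "t \<in> grid_cell n k"
        and sum: "(\<Sum>k<Suc n. f k * of_bool (t \<in> grid_cell n k)) = (f k :: real)" for f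
        using sum_grid_cells[of t n] t by auto
      have "real (Suc k) / real (Suc n) = real k / real (Suc n) + inverse (real (Suc n))"
        by (simp add: add_divide_distrib inverse_eq_divide)
      with k elim have "b < real k / real (Suc n)" "real k / real (Suc n) < t"
        by (auto simp: grid_cell_def)
      from b(2)[OF this] show ?case
        using sum[of "\<lambda>k. of_bool (book_count X (real k / real (Suc n)) {0..q} \<omega> \<noteq> 0)"] by simp
    qed
    then show ?thesis by (rule tendsto_eventually)
  qed
  have "(\<lambda>n. discretised_executions X q n \<omega>) \<longlonglongrightarrow> (\<Sum>t\<in>market X \<omega> \<inter> {0<..1}. of_bool (?P t))"
    unfolding discretised_executions_eq by (intro tendsto_sum lim)
  also have "(\<Sum>t\<in>market X \<omega> \<inter> {0<..1}. of_bool (?P t)) =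
      real (card (executed X ({0..q} \<times> {0<..1}) \<omega>))"
    unfolding card_executed[OF paths] using fin by (simp add: of_bool_def sum.If_cases Int_def)
  finally show ?thesis .
qed

end

section \<open>Mean flows through the book\<close>

text \<open>By Tonelli the intensity of the strip is the price integral times the unit length of the
  time window.\<close>

lemma limit_intensity_strip:
  assumes alpha: "\<alpha> \<ge> 0" and hl: "\<And>u. u \<ge> 0 \<Longrightarrow> hl u \<ge> 0"
    and int: "\<And>q. q \<ge> 0 \<Longrightarrow> set_integrable lborel {0..q} hl"
    and A: "A \<in> sets borel" "A \<subseteq> {0..q}" and q: "q \<ge> 0"
  shows "A \<times> {0<..1} \<in> sets (limit_intensity \<alpha> hl)"
    and "emeasure (limit_intensity \<alpha> hl) (A \<times> {0<..1}) = ennreal (\<alpha> * (LINT u:A|lborel. hl u))"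
proof -
  \<comment> \<open>The hypotheses control \<open>hl\<close> on bounded intervals of nonnegative
    prices only. Its cut-off \<open>g\<close> is globally measurable, as a limit of truncations, and
    gives the same density.\<close>
  define g where "g u = indicat_real {0..} u * hl u" for u
  have "(\<lambda>u. indicat_real {0..real n} u * hl u) \<in> borel_measurable borel" for n
    using int[of "real n"] by (simp add: set_integrable_def integrable_iff_bounded)
  moreover have "(\<lambda>n. indicat_real {0..real n} u * hl u) \<longlonglongrightarrow> g u" for u
  proof (rule tendsto_eventually)
    have "eventually (\<lambda>n. u \<le> real n) sequentially"
      using eventually_ge_at_top[of "nat \<lceil>u\<rceil>"] by eventually_elim linarith
    then show "eventually (\<lambda>n. indicat_real {0..real n} u * hl u = g u) sequentially"
      by eventually_elim (auto simp: g_def indicator_def)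
  qed
  ultimately have [measurable]: "g \<in> borel_measurable borel"
    by (rule borel_measurable_LIMSEQ_real[rotated])
  note [measurable] = A(1)
  have meas: "A \<times> {0<..1::real} \<in> sets borel"
    by (simp add: borel_prod[symmetric])
  then show "A \<times> {0<..1} \<in> sets (limit_intensity \<alpha> hl)"
    by (simp add: limit_intensity_def)
  have dens: "(\<lambda>(u, t). ennreal (\<alpha> * hl u) * indicator ({0..} \<times> {0<..}) (u, t)) =
      (\<lambda>(u, t::real). ennreal (\<alpha> * g u) * indicator {0<..} t)"
    by (auto simp: g_def indicator_def fun_eq_iff)
  have "(\<lambda>(u, t::real). ennreal (\<alpha> * g u) * indicator {0<..} t) \<in> borel_measurable (borel \<Otimes>\<^sub>M borel)"
    by measurable
  then have m: "(\<lambda>(u, t::real). ennreal (\<alpha> * g u) * indicator {0<..} t) \<in> borel_measurable borel"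
    by (simp add: borel_prod)
  have "emeasure (limit_intensity \<alpha> hl) (A \<times> {0<..1}) =
      (\<integral>\<^sup>+x. (\<lambda>(u, t::real). ennreal (\<alpha> * g u) * indicator {0<..} t) x * indicator (A \<times> {0<..1}) x \<partial>lborel)"
    unfolding limit_intensity_def dens using m meas by (subst emeasure_density) auto
  also have "\<dots> = (\<integral>\<^sup>+x. (case x of (u, t) \<Rightarrow> ennreal (\<alpha> * g u) * indicator A u * indicator {0<..1::real} t)
      \<partial>(lborel \<Otimes>\<^sub>M lborel))"
    unfolding lborel_prod
    by (rule nn_integral_cong) (auto simp: indicator_def split: if_splits)
  also have "\<dots> = (\<integral>\<^sup>+u. (\<integral>\<^sup>+t. ennreal (\<alpha> * g u) * indicator A u * indicator {0<..1::real} t \<partial>lborel) \<partial>lborel)"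
    by (subst lborel.nn_integral_fst[symmetric]) auto
  also have "\<dots> = (\<integral>\<^sup>+u. ennreal (\<alpha> * g u) * indicator A u \<partial>lborel)"
    by (simp add: nn_integral_cmult)
  also have "\<dots> = (\<integral>\<^sup>+u. ennreal (\<alpha> * (indicator A u *\<^sub>R hl u)) \<partial>lborel)"
    using A(2) by (intro nn_integral_cong) (auto simp: g_def indicator_def)
  also have "\<dots> = ennreal (\<integral>u. \<alpha> * (indicator A u *\<^sub>R hl u) \<partial>lborel)"
  proof (rule nn_integral_eq_integral)
    have "set_integrable lborel A hl"
      by (rule set_integrable_subset[OF int[OF q]]) (use A in auto)
    then show "integrable lborel (\<lambda>u. \<alpha> * (indicator A u *\<^sub>R hl u))"
      unfolding set_integrable_def by (rule integrable_mult_right)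
    show "AE u in lborel. 0 \<le> \<alpha> * (indicator A u *\<^sub>R hl u)"
      by (rule AE_I2) (use A(2) alpha hl in \<open>auto simp: indicator_def\<close>)
  qed
  also have "\<dots> = ennreal (\<alpha> * (LINT u:A|lborel. hl u))"
    by (simp add: set_lebesgue_integral_def)
  finally show "emeasure (limit_intensity \<alpha> hl) (A \<times> {0<..1}) = ennreal (\<alpha> * (LINT u:A|lborel. hl u))" .
qed

lemma market_intensity_interval:
  assumes "0 \<le> \<mu>" "0 \<le> a" "a \<le> b"
  shows "emeasure (market_intensity \<mu>) {a<..b} = ennreal (\<mu> * (b - a))"
proof -
  have "emeasure (market_intensity \<mu>) {a<..b} = (\<integral>\<^sup>+t. ennreal \<mu> * indicator {0<..} t * indicator {a<..b} t \<partial>lborel)"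
    unfolding market_intensity_def by (subst emeasure_density) auto
  also have "\<dots> = (\<integral>\<^sup>+t. ennreal \<mu> * indicator {a<..b} t \<partial>lborel)"
    using assms by (intro nn_integral_cong) (auto simp: indicator_def)
  also have "\<dots> = ennreal (\<mu> * (b - a))"
    using assms by (simp add: nn_integral_cmult ennreal_mult)
  finally show ?thesis .
qed

context
  fixes M :: "'w measure" and F :: "real \<Rightarrow> 'w measure" and X :: "'w order_book"
    and hl :: "real \<Rightarrow> real" and \<alpha> \<mu> \<theta> :: real
  assumes alpha: "\<alpha> \<ge> 0" and mu: "\<mu> \<ge> 0" and theta: "\<theta> > 0"
    and hl_nonneg: "\<And>u. u \<ge> 0 \<Longrightarrow> hl u \<ge> 0"
    and hl_int: "\<And>q. q \<ge> 0 \<Longrightarrow> set_integrable lborel {0..q} hl"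
    and book: "one_side_book M F X \<alpha> hl \<mu> \<theta>"
    and stat: "stationary_regime M X \<alpha> hl \<mu> \<theta>"
begin

interpretation prob_space M
  using book by (simp add: one_side_book_def)

lemma set_integrable_hl:
  assumes "A \<in> sets borel" "A \<subseteq> {0..q}"
  shows "set_integrable lborel A hl"
proof (cases "0 \<le> q")
  case True
  show ?thesis by (rule set_integrable_subset[OF hl_int[OF True]]) (use assms in auto)
next
  case False
  with assms have "A = {}" by auto
  then show ?thesis by (simp add: set_integrable_def)
qed

lemma limit_rate_nonneg: "0 \<le> limit_rate \<alpha> hl q"
  unfolding limit_rate_def set_lebesgue_integral_def
  by (intro mult_nonneg_nonneg alpha Bochner_Integration.integral_nonneg) (auto simp: hl_nonneg indicator_def)

text \<open>The closed window is the one in \<open>cancelled_fraction\<close>, the half-open one is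
  additive; they differ by the null set \<open>{p}\<close>.\<close>

lemma limit_rate_diff:
  assumes "0 \<le> p" "p \<le> q"
  shows "\<alpha> * (LINT u:{p<..q}|lborel. hl u) = limit_rate \<alpha> hl q - limit_rate \<alpha> hl p"
    and "\<alpha> * (LINT u:{p..q}|lborel. hl u) = limit_rate \<alpha> hl q - limit_rate \<alpha> hl p"
proof -
  have eq: "{0..q} = {0..p} \<union> {p<..q}" using assms by auto
  have "(LINT u:{0..q}|lborel. hl u) = (LINT u:{0..p}|lborel. hl u) + (LINT u:{p<..q}|lborel. hl u)"
    unfolding eq using assms
    by (intro set_integral_Un set_integrable_hl[of _ q]) auto
  then show 1: "\<alpha> * (LINT u:{p<..q}|lborel. hl u) = limit_rate \<alpha> hl q - limit_rate \<alpha> hl p"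
    by (simp add: limit_rate_def algebra_simps)
  have meas: "set_borel_measurable lborel A hl" if "A \<in> sets borel" "A \<subseteq> {0..q}" for A
    using set_integrable_hl[OF that] unfolding set_borel_measurable_def set_integrable_def
    by (rule borel_measurable_integrable)
  have "(LINT u:{p..q}|lborel. hl u) = (LINT u:{p<..q}|lborel. hl u)"
  proof (rule set_integral_cong_set)
    show "AE x in lborel. (x \<in> {p<..q}) = (x \<in> {p..q})"
      using AE_lborel_singleton[of p] by eventually_elim auto
  qed (use assms in \<open>auto intro!: meas\<close>)
  with 1 show "\<alpha> * (LINT u:{p..q}|lborel. hl u) = limit_rate \<alpha> hl q - limit_rate \<alpha> hl p" by simp
qed

lemma submitted_mean:
  assumes A: "A \<in> sets borel" "A \<subseteq> {0..q}" and q: "0 \<le> q"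
  shows "integrable M (\<lambda>\<omega>. real (card (submitted X (A \<times> {0<..1}) \<omega>)))"
    and "(LINT \<omega>|M. real (card (submitted X (A \<times> {0<..1}) \<omega>))) = \<alpha> * (LINT u:A|lborel. hl u)"
proof -
  have P: "poisson_process M (submitted X) (limit_intensity \<alpha> hl)"
    using book by (simp add: one_side_book_def)
  have I: "A \<times> {0<..1} \<in> sets (limit_intensity \<alpha> hl)"
    "emeasure (limit_intensity \<alpha> hl) (A \<times> {0<..1}) = ennreal (\<alpha> * (LINT u:A|lborel. hl u))"
    by (rule limit_intensity_strip[OF alpha _ _ A q]; simp add: hl_nonneg hl_int)+
  have fin: "emeasure (limit_intensity \<alpha> hl) (A \<times> {0<..1}) < \<infinity>"
    unfolding I(2) by simp
  note mean = poisson_process_mean[OF prob_space_axioms P I(1) fin]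
  show "integrable M (\<lambda>\<omega>. real (card (submitted X (A \<times> {0<..1}) \<omega>)))" by (rule mean(1))
  have "0 \<le> (LINT u:A|lborel. hl u)"
    unfolding set_lebesgue_integral_def
    using A by (intro Bochner_Integration.integral_nonneg) (auto simp: indicator_def hl_nonneg)
  then have "0 \<le> \<alpha> * (LINT u:A|lborel. hl u)" using alpha by simp
  then show "(LINT \<omega>|M. real (card (submitted X (A \<times> {0<..1}) \<omega>))) = \<alpha> * (LINT u:A|lborel. hl u)"
    unfolding mean(2) using I(2) by (simp add: Sigma_Algebra.measure_def)
qed

section \<open>The number of standing orders at a fixed time\<close>

lemma subalgebra_history: "subalgebra M (F t)"
  using book by (simp add: one_side_book_def arrivals_wrt_history_def)

lemma book_count_history:
  assumes "0 \<le> t" shows "book_count X t {0..q} \<in> measurable (F t) (count_space UNIV)"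
  using book assms by (simp add: one_side_book_def arrivals_wrt_history_def)

lemma book_count_measurable:
  assumes "0 \<le> t" shows "book_count X t {0..q} \<in> measurable M (count_space UNIV)"
  using measurable_from_subalg[OF subalgebra_history book_count_history[OF assms]] .

lemma book_count_law:
  assumes "0 \<le> t" "0 \<le> q"
  shows "distr M (count_space UNIV) (book_count X t {0..q}) = measure_pmf (book_law \<alpha> hl \<mu> \<theta> q)"
  using stat assms by (simp add: stationary_regime_def)

text \<open>The mean is finite and does not depend on \<open>t\<close>, so the standing orders at
  times 0 and 1 cancel in the mean balance.\<close>

lemma book_count_mean:
  assumes t: "0 \<le> t" and q: "0 \<le> q"
  shows "integrable M (\<lambda>\<omega>. real (book_count X t {0..q} \<omega>))"
    and "(LINT \<omega>|M. real (book_count X t {0..q} \<omega>)) = bd_mean \<mu> \<theta> (limit_rate \<alpha> hl q)"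
proof -
  have "integrable (distr M (count_space UNIV) (book_count X t {0..q})) real"
    unfolding book_count_law[OF t q] by (rule book_law_mean[OF mu theta limit_rate_nonneg])
  then show "integrable M (\<lambda>\<omega>. real (book_count X t {0..q} \<omega>))"
    using book_count_measurable[OF t, of q] by (subst (asm) integrable_distr_eq) auto
  have "(LINT \<omega>|M. real (book_count X t {0..q} \<omega>)) =
      integral\<^sup>L (distr M (count_space UNIV) (book_count X t {0..q})) real"
    using book_count_measurable[OF t, of q] by (subst integral_distr) auto
  then show "(LINT \<omega>|M. real (book_count X t {0..q} \<omega>)) = bd_mean \<mu> \<theta> (limit_rate \<alpha> hl q)"
    unfolding book_count_law[OF t q] by (simp add: book_law_mean[OF mu theta limit_rate_nonneg])
qed

lemma prob_book_nonempty:
  assumes t: "0 \<le> t" and q: "0 \<le> q"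
  shows "prob {\<omega> \<in> space M. book_count X t {0..q} \<omega> \<noteq> 0} = 1 - 1 / bd_partition \<mu> \<theta> (limit_rate \<alpha> hl q)"
proof -
  note m [measurable] = book_count_measurable[OF t, of q]
  have "prob {\<omega> \<in> space M. book_count X t {0..q} \<omega> = 0} =
      measure (distr M (count_space UNIV) (book_count X t {0..q})) {0}"
    using m by (subst measure_distr) (auto intro!: arg_cong[where f = prob])
  also have "\<dots> = pmf (book_law \<alpha> hl \<mu> \<theta> q) 0"
    unfolding book_count_law[OF t q] by (simp add: pmf.rep_eq)
  finally have "prob {\<omega> \<in> space M. book_count X t {0..q} \<omega> = 0} = 1 / bd_partition \<mu> \<theta> (limit_rate \<alpha> hl q)"
    by (simp add: pmf_book_law_0[OF mu theta limit_rate_nonneg])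
  moreover have "prob {\<omega> \<in> space M. book_count X t {0..q} \<omega> \<noteq> 0} =
      1 - prob {\<omega> \<in> space M. book_count X t {0..q} \<omega> = 0}"
    by (intro prob_neg) measurable
  ultimately show ?thesis by simp
qed

section \<open>Market orders and the mean of the discretised executions\<close>

lemma market_orders_law:
  assumes "0 \<le> a" "a \<le> b"
  shows "(\<lambda>\<omega>. card (market_in X {a<..b} \<omega>)) \<in> measurable M (count_space UNIV)"
    and "prob {\<omega> \<in> space M. card (market_in X {a<..b} \<omega>) = k} =
      (\<mu> * (b - a)) ^ k / fact k * exp (- (\<mu> * (b - a)))"
proof -
  have P: "poisson_process M (market_in X) (market_intensity \<mu>)"
    using book by (simp add: one_side_book_def)
  have A: "{a<..b} \<in> sets (market_intensity \<mu>)" "emeasure (market_intensity \<mu>) {a<..b} < \<infinity>"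
    "measure (market_intensity \<mu>) {a<..b} = \<mu> * (b - a)"
    using market_intensity_interval[OF mu assms] mu assms
    by (auto simp: market_intensity_def Sigma_Algebra.measure_def)
  from P A(1,2) show "(\<lambda>\<omega>. card (market_in X {a<..b} \<omega>)) \<in> measurable M (count_space UNIV)"
    unfolding poisson_process_def by blast
  from P A(1,2) have "prob {\<omega> \<in> space M. card (market_in X {a<..b} \<omega>) = k} =
      measure (market_intensity \<mu>) {a<..b} ^ k / fact k * exp (- measure (market_intensity \<mu>) {a<..b})"
    unfolding poisson_process_def by blast
  then show "prob {\<omega> \<in> space M. card (market_in X {a<..b} \<omega>) = k} =
      (\<mu> * (b - a)) ^ k / fact k * exp (- (\<mu> * (b - a)))"
    unfolding A(3) .
qed

lemma integrable_market_orders: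
  assumes "0 \<le> a" "a \<le> b"
  shows "integrable M (\<lambda>\<omega>. real (card (market_in X {a<..b} \<omega>)))"
proof (rule expectation_nat_sums(1)[OF market_orders_law(1)[OF assms]])
  show "(\<lambda>k. real k * prob {\<omega> \<in> space M. card (market_in X {a<..b} \<omega>) = k}) sums (\<mu> * (b - a))"
    unfolding market_orders_law(2)[OF assms] by (rule poisson_mean_sums)
qed

text \<open>Whether the book is empty at time \<open>a\<close> belongs to the history
  \<open>F a\<close>, which is independent of the market orders after \<open>a\<close>. For
  \<open>k > 0\<close> the product equals \<open>k\<close> exactly if the book is nonempty and
  \<open>k\<close> market orders arrive; \<open>k = 0\<close> adds nothing to the mean.\<close>

lemma execution_trials_mean:
  assumes a: "0 \<le> a" and b: "a \<le> b" and q: "0 \<le> q"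
  shows "integrable M (\<lambda>\<omega>. of_bool (book_count X a {0..q} \<omega> \<noteq> 0) * real (card (market_in X {a<..b} \<omega>)))"
    and "(LINT \<omega>|M. of_bool (book_count X a {0..q} \<omega> \<noteq> 0) * real (card (market_in X {a<..b} \<omega>))) =
      (1 - 1 / bd_partition \<mu> \<theta> (limit_rate \<alpha> hl q)) * (\<mu> * (b - a))"
proof -
  define G where "G = {\<omega> \<in> space M. book_count X a {0..q} \<omega> \<noteq> 0}"
  define N where "N \<omega> = of_bool (book_count X a {0..q} \<omega> \<noteq> 0) * card (market_in X {a<..b} \<omega>)" for \<omega>
  let ?K = "\<lambda>k. {\<omega> \<in> space M. card (market_in X {a<..b} \<omega>) = k}"
  have G: "G \<in> sets (F a)"
  proof -
    have "book_count X a {0..q} -` (- {0}) \<inter> space (F a) \<in> sets (F a)"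
      using book_count_history[OF a, of q] by (rule measurable_sets) simp
    moreover have "book_count X a {0..q} -` (- {0}) \<inter> space (F a) = G"
      using subalgebra_history[of a] by (auto simp: G_def subalgebra_def)
    ultimately show ?thesis by simp
  qed
  have indep: "prob (G \<inter> ?K k) = prob G * prob (?K k)" for k
  proof -
    let ?E = "\<lambda>j::nat. if j = 0 then sets (F a)
           else if j = 1 then sigma_sets (space M)
             (count_events M (submitted X) {A \<in> sets borel. A \<subseteq> UNIV \<times> {a<..}})
           else sigma_sets (space M)
             (count_events M (market_in X) {A \<in> sets borel. A \<subseteq> {a<..}})"
    have E: "indep_sets ?E {0, 1, 2}"
      using book a unfolding one_side_book_def arrivals_wrt_history_def by blast
    have "?K k \<in> count_events M (market_in X) {A \<in> sets borel. A \<subseteq> {a<..}}"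
      unfolding count_events_def by (rule CollectI, rule exI[of _ "{a<..b}"], rule exI[of _ k]) auto
    \<comment> \<open>Index 0 is the history at \<open>a\<close>, index 2 the later market
      orders.\<close>
    then have "\<forall>j\<in>{0, 2}. (if j = 0 then G else ?K k) \<in> ?E j"
      using G by (auto intro: sigma_sets.Basic)
    from indep_setsD[OF E _ _ _ this]
    show ?thesis by (simp add: Int_commute)
  qed
  have N: "N \<in> measurable M (count_space UNIV)"
  proof -
    note [measurable] = book_count_measurable[OF a, of q] market_orders_law(1)[OF a b]
    show ?thesis unfolding N_def by measurable
  qed
  have "real k * prob {\<omega> \<in> space M. N \<omega> = k} = prob G * (real k * prob (?K k))" for k
  proof (cases "k = 0")
    case False
    then have "{\<omega> \<in> space M. N \<omega> = k} = G \<inter> ?K k" by (auto simp: N_def G_def)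
    with indep show ?thesis by simp
  qed simp
  moreover have "(\<lambda>k. prob G * (real k * prob (?K k))) sums (prob G * (\<mu> * (b - a)))"
    unfolding market_orders_law(2)[OF a b] by (intro sums_mult poisson_mean_sums)
  ultimately have s: "(\<lambda>k. real k * prob {\<omega> \<in> space M. N \<omega> = k}) sums (prob G * (\<mu> * (b - a)))"
    by (simp only:)
  have eq: "(\<lambda>\<omega>. real (N \<omega>)) =
      (\<lambda>\<omega>. of_bool (book_count X a {0..q} \<omega> \<noteq> 0) * real (card (market_in X {a<..b} \<omega>)))"
    by (simp add: N_def fun_eq_iff)
  show "integrable M (\<lambda>\<omega>. of_bool (book_count X a {0..q} \<omega> \<noteq> 0) * real (card (market_in X {a<..b} \<omega>)))"
    using expectation_nat_sums(1)[OF N s] by (simp only: eq)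
  show "(LINT \<omega>|M. of_bool (book_count X a {0..q} \<omega> \<noteq> 0) * real (card (market_in X {a<..b} \<omega>))) =
      (1 - 1 / bd_partition \<mu> \<theta> (limit_rate \<alpha> hl q)) * (\<mu> * (b - a))"
    using expectation_nat_sums(2)[OF N s] unfolding eq G_def prob_book_nonempty[OF a q] .
qed

text \<open>By stationarity the book is nonempty with the same probability at every grid point, and
  the cells have total length 1. The mean is thus the same for every \<open>n\<close>.\<close>

lemma discretised_executions_mean:
  assumes q: "0 \<le> q"
  shows "integrable M (discretised_executions X q n)"
    and "(LINT \<omega>|M. discretised_executions X q n \<omega>) =
      \<mu> * (1 - 1 / bd_partition \<mu> \<theta> (limit_rate \<alpha> hl q))"
proof -
  have le: "real k / real (Suc n) \<le> real (Suc k) / real (Suc n)" for k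
    by (intro divide_right_mono) auto
  note trial = execution_trials_mean[OF _ le q, folded grid_cell_def]
  show "integrable M (discretised_executions X q n)"
    unfolding discretised_executions_def[abs_def]
    by (intro Bochner_Integration.integrable_sum trial) simp
  have "(LINT \<omega>|M. discretised_executions X q n \<omega>) =
    (\<Sum>k<Suc n. (1 - 1 / bd_partition \<mu> \<theta> (limit_rate \<alpha> hl q)) *
      (\<mu> * (real (Suc k) / real (Suc n) - real k / real (Suc n))))"
    unfolding discretised_executions_def
    by (subst Bochner_Integration.integral_sum) (intro trial sum.cong refl; simp)+
  also have "\<dots> = (\<Sum>k<Suc n. (1 - 1 / bd_partition \<mu> \<theta> (limit_rate \<alpha> hl q)) * \<mu> / real (Suc n))"
    by (intro sum.cong) (simp_all add: field_simps)
  also have "\<dots> = \<mu> * (1 - 1 / bd_partition \<mu> \<theta> (limit_rate \<alpha> hl q))"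
    by (simp del: sum.lessThan_Suc)
  finally show "(LINT \<omega>|M. discretised_executions X q n \<omega>) =
      \<mu> * (1 - 1 / bd_partition \<mu> \<theta> (limit_rate \<alpha> hl q))" .
qed

section \<open>Almost sure path properties, measurability, and the mean number of executions\<close>

lemma AE_paths: "AE \<omega> in M. book_paths X \<omega>"
  using book by (simp add: one_side_book_def)

lemma AE_life_pos: "AE \<omega> in M. \<forall>i. 0 < life X i \<omega>"
proof (subst AE_all_countable, rule allI)
  fix i
  have D: "distributed M lborel (life X i) (exponential_density \<theta>)"
    using book by (simp add: one_side_book_def exponential_lifetimes_def)
  have "AE x in density lborel (\<lambda>x. ennreal (exponential_density \<theta> x)). 0 < x"
    using AE_lborel_singleton[of 0] by (subst AE_density) (auto simp: exponential_density_def)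
  then have "AE x in distr M lborel (life X i). 0 < x"
    unfolding distributed_distr_eq_density[OF D] .
  then show "AE \<omega> in M. 0 < life X i \<omega>"
    using distributed_measurable[OF D] by (subst (asm) AE_distr_iff) auto
qed

lemma book_measurable [measurable]:
  "{\<omega> \<in> space M. i \<in> orders X \<omega>} \<in> sets M" "price X i \<in> borel_measurable M"
  "subm X i \<in> borel_measurable M" "life X i \<in> borel_measurable M" "exec X i \<in> borel_measurable M"
  using book by (auto simp: one_side_book_def measurable_book_def)

lemma card_cancelled_measurable:
  assumes [measurable]: "A \<in> sets borel"
  shows "(\<lambda>\<omega>. real (card (cancelled X (A \<times> {0<..1}) \<omega>))) \<in> borel_measurable M"
proof -
  have "(\<lambda>\<omega>. card (cancelled X (A \<times> {0<..1}) \<omega>)) \<in> measurable M (count_space UNIV)"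
    by (rule measurable_card) (simp add: cancelled_def)
  then show ?thesis by measurable
qed

lemma card_executed_measurable:
  assumes [measurable]: "A \<in> sets borel"
  shows "(\<lambda>\<omega>. real (card (executed X (A \<times> {0<..1}) \<omega>))) \<in> borel_measurable M"
proof -
  \<comment> \<open>The uncountable existential becomes extended-real inequalities, which are
    visibly measurable; the bounds 0 and 1 exclude infinite values.\<close>
  have eq: "(\<exists>t. exec X i \<omega> = ereal t \<and> (price X i \<omega>, t) \<in> A \<times> {0<..1}) \<longleftrightarrow>
      0 < exec X i \<omega> \<and> exec X i \<omega> \<le> 1 \<and> price X i \<omega> \<in> A" for i \<omega>
    by (cases "exec X i \<omega>") auto
  have "(\<lambda>\<omega>. card (executed X (A \<times> {0<..1}) \<omega>)) \<in> measurable M (count_space UNIV)"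
    by (rule measurable_card) (simp only: executed_def eq mem_Collect_eq, measurable)
  then show ?thesis by measurable
qed

text \<open>Dominated convergence along the grids, bounded by the number of market orders in the
  window. The approximating means are constant, so the limit is that constant.\<close>

lemma executed_mean:
  assumes q: "0 \<le> q"
  shows "integrable M (\<lambda>\<omega>. real (card (executed X ({0..q} \<times> {0<..1}) \<omega>)))"
    and "(LINT \<omega>|M. real (card (executed X ({0..q} \<times> {0<..1}) \<omega>))) =
      \<mu> * (1 - 1 / bd_partition \<mu> \<theta> (limit_rate \<alpha> hl q))"
proof -
  let ?f = "\<lambda>\<omega>. real (card (executed X ({0..q} \<times> {0<..1}) \<omega>))"
  let ?w = "\<lambda>\<omega>. real (card (market_in X {0<..1} \<omega>))"
  have f: "?f \<in> borel_measurable M" by (rule card_executed_measurable) simp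
  have s: "discretised_executions X q n \<in> borel_measurable M" for n
    using discretised_executions_mean(1)[OF q] by (rule borel_measurable_integrable)
  have w: "integrable M ?w" by (rule integrable_market_orders) auto
  have lim: "AE \<omega> in M. (\<lambda>n. discretised_executions X q n \<omega>) \<longlonglongrightarrow> ?f \<omega>"
    using AE_paths by eventually_elim (rule discretised_executions_tendsto)
  have bound: "AE \<omega> in M. norm (discretised_executions X q n \<omega>) \<le> ?w \<omega>" for n
    using AE_paths by eventually_elim (simp add: discretised_executions_bounds)
  show "integrable M ?f"
    by (rule integrable_dominated_convergence[OF f s w lim bound])
  have "(\<lambda>n. LINT \<omega>|M. discretised_executions X q n \<omega>) \<longlonglongrightarrow> integral\<^sup>L M ?f"
    by (rule integral_dominated_convergence[OF f s w lim bound])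
  then show "integral\<^sup>L M ?f = \<mu> * (1 - 1 / bd_partition \<mu> \<theta> (limit_rate \<alpha> hl q))"
    unfolding discretised_executions_mean(2)[OF q] by (simp add: LIMSEQ_const_iff)
qed

section \<open>Mean numbers of cancellations\<close>

lemma cancelled_mean:
  assumes q: "0 \<le> q"
  shows "integrable M (\<lambda>\<omega>. real (card (cancelled X ({0..q} \<times> {0<..1}) \<omega>)))"
    and "(LINT \<omega>|M. real (card (cancelled X ({0..q} \<times> {0<..1}) \<omega>))) =
      \<theta> * bd_mean \<mu> \<theta> (limit_rate \<alpha> hl q)"
proof -
  let ?C = "\<lambda>\<omega>. real (card (cancelled X ({0..q} \<times> {0<..1}) \<omega>))"
  let ?R = "\<lambda>\<omega>. real (book_count X 0 {0..q} \<omega>) + real (card (submitted X ({0..q} \<times> {0<..1}) \<omega>)) -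
      real (book_count X 1 {0..q} \<omega>) - real (card (executed X ({0..q} \<times> {0<..1}) \<omega>))"
  \<comment> \<open>Flow conservation solved for the cancellations, so that their integrability and
    mean are inherited from the other four counts.\<close>
  have eq: "AE \<omega> in M. ?R \<omega> = ?C \<omega>"
    using AE_paths AE_life_pos
  proof eventually_elim
    case (elim \<omega>)
    then show ?case using flow_conservation[of X \<omega> "{0..q}" q 1] by auto
  qed
  have sub: "integrable M (\<lambda>\<omega>. real (card (submitted X ({0..q} \<times> {0<..1}) \<omega>)))"
    "(LINT \<omega>|M. real (card (submitted X ({0..q} \<times> {0<..1}) \<omega>))) = limit_rate \<alpha> hl q"
    using submitted_mean[of "{0..q}" q] q by (auto simp: limit_rate_def)
  have meas: "?R \<in> borel_measurable M" "?C \<in> borel_measurable M"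
    using book_count_mean(1)[of 0 q] book_count_mean(1)[of 1 q] sub(1) executed_mean(1)[OF q] q
      card_cancelled_measurable[of "{0..q}"] by auto
  have R: "integrable M ?R"
    using book_count_mean(1)[of 0 q] book_count_mean(1)[of 1 q] sub(1) executed_mean(1)[OF q] q by auto
  show "integrable M ?C"
    using R integrable_cong_AE[OF meas eq] by simp
  have "integral\<^sup>L M ?C = integral\<^sup>L M ?R"
    by (rule integral_cong_AE[OF meas eq, symmetric])
  also have "\<dots> = limit_rate \<alpha> hl q - \<mu> * (1 - 1 / bd_partition \<mu> \<theta> (limit_rate \<alpha> hl q))"
    using book_count_mean[of 0 q] book_count_mean[of 1 q] sub executed_mean[OF q] q by simp
  also have "\<dots> = \<theta> * bd_mean \<mu> \<theta> (limit_rate \<alpha> hl q)"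
    using theta by (simp add: bd_mean_def)
  finally show "integral\<^sup>L M ?C = \<theta> * bd_mean \<mu> \<theta> (limit_rate \<alpha> hl q)" .
qed

text \<open>\<open>card\<close> is 0 on infinite sets and monotone only into finite ones, so the
  comparison holds almost surely, where the cancelled sets are finite.\<close>

lemma cancelled_mean_mono:
  assumes A: "A \<in> sets borel" "B \<in> sets borel" "A \<subseteq> B" "B \<subseteq> {0..q}" and q: "0 \<le> q"
  shows "integrable M (\<lambda>\<omega>. real (card (cancelled X (B \<times> {0<..1}) \<omega>)))"
    and "(LINT \<omega>|M. real (card (cancelled X (A \<times> {0<..1}) \<omega>))) \<le>
      (LINT \<omega>|M. real (card (cancelled X (B \<times> {0<..1}) \<omega>)))"
proof -
  have le: "AE \<omega> in M. card (cancelled X (C \<times> {0<..1}) \<omega>) \<le> card (cancelled X (D \<times> {0<..1}) \<omega>)"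
    if "C \<subseteq> D" "D \<subseteq> {0..q}" for C D
    using AE_paths AE_life_pos
  proof eventually_elim
    case (elim \<omega>)
    have "finite (cancelled X (D \<times> {0<..1}) \<omega>)"
      using elim that by (intro finite_cancelled[of _ _ _ q]) auto
    then show ?case
      using that by (intro card_mono) (auto simp: cancelled_def)
  qed
  have int: "integrable M (\<lambda>\<omega>. real (card (cancelled X (C \<times> {0<..1}) \<omega>)))"
    if "C \<in> sets borel" "C \<subseteq> {0..q}" for C
    using cancelled_mean(1)[OF q] card_cancelled_measurable[OF that(1)]
  proof (rule Bochner_Integration.integrable_bound)
    show "AE \<omega> in M. norm (real (card (cancelled X (C \<times> {0<..1}) \<omega>))) \<le>
        norm (real (card (cancelled X ({0..q} \<times> {0<..1}) \<omega>)))"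
      using le[OF that(2)] by auto
  qed
  show "integrable M (\<lambda>\<omega>. real (card (cancelled X (B \<times> {0<..1}) \<omega>)))"
    using A by (intro int) auto
  show "(LINT \<omega>|M. real (card (cancelled X (A \<times> {0<..1}) \<omega>))) \<le>
      (LINT \<omega>|M. real (card (cancelled X (B \<times> {0<..1}) \<omega>)))"
    using A le[of A B] by (intro integral_mono_AE int) auto
qed

text \<open>The mean is known for initial segments of prices; subtracting two of them gives the
  interval between.\<close>

lemma cancelled_mean_half_open:
  assumes q: "0 \<le> q" "q \<le> r"
  shows "(LINT \<omega>|M. real (card (cancelled X ({q<..r} \<times> {0<..1}) \<omega>))) =
      \<theta> * (bd_mean \<mu> \<theta> (limit_rate \<alpha> hl r) - bd_mean \<mu> \<theta> (limit_rate \<alpha> hl q))"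
proof -
  have r: "0 \<le> r" using q by simp
  have split: "AE \<omega> in M. real (card (cancelled X ({0..r} \<times> {0<..1}) \<omega>)) =
      real (card (cancelled X ({0..q} \<times> {0<..1}) \<omega>)) + real (card (cancelled X ({q<..r} \<times> {0<..1}) \<omega>))"
    using AE_paths AE_life_pos
  proof eventually_elim
    case (elim \<omega>)
    have "cancelled X ({0..r} \<times> {0<..1}) \<omega> =
        cancelled X ({0..q} \<times> {0<..1}) \<omega> \<union> cancelled X ({q<..r} \<times> {0<..1}) \<omega>"
      using q by (auto simp: cancelled_def)
    moreover have "cancelled X ({0..q} \<times> {0<..1}) \<omega> \<inter> cancelled X ({q<..r} \<times> {0<..1}) \<omega> = {}"
      by (auto simp: cancelled_def)
    moreover have "finite (cancelled X (A \<times> {0<..1}) \<omega>)" if "A \<subseteq> {..r}" for A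
      using elim that by (intro finite_cancelled[of _ _ _ r]) auto
    then have "finite (cancelled X ({0..q} \<times> {0<..1}) \<omega>)" "finite (cancelled X ({q<..r} \<times> {0<..1}) \<omega>)"
      using q by (simp_all add: subset_eq)
    ultimately show ?case by (simp add: card_Un_disjoint)
  qed
  have int: "integrable M (\<lambda>\<omega>. real (card (cancelled X ({q<..r} \<times> {0<..1}) \<omega>)))"
    \<comment> \<open>Only integrability for the larger set is wanted, so the smaller one is taken
      empty.\<close>
    using q by (intro cancelled_mean_mono(1)[where q = r and A = "{}"]) auto
  have "(LINT \<omega>|M. real (card (cancelled X ({0..r} \<times> {0<..1}) \<omega>))) =
      (LINT \<omega>|M. real (card (cancelled X ({0..q} \<times> {0<..1}) \<omega>)) +
        real (card (cancelled X ({q<..r} \<times> {0<..1}) \<omega>)))"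
    using split int cancelled_mean(1)[OF r] cancelled_mean(1)[OF q(1)]
    by (intro integral_cong_AE) auto
  then show ?thesis
    using int cancelled_mean[OF r] cancelled_mean[OF q(1)] by (simp add: algebra_simps)
qed

section \<open>Letting the price window shrink\<close>

lemma limit_rate_mono:
  assumes "0 \<le> p" "p \<le> q" shows "limit_rate \<alpha> hl p \<le> limit_rate \<alpha> hl q"
proof -
  have "0 \<le> (LINT u:{p..q}|lborel. hl u)"
    unfolding set_lebesgue_integral_def
    using assms by (intro Bochner_Integration.integral_nonneg) (auto simp: indicator_def hl_nonneg)
  with alpha have "0 \<le> \<alpha> * (LINT u:{p..q}|lborel. hl u)" by simp
  then show ?thesis unfolding limit_rate_diff(2)[OF assms] by simp
qed

text \<open>The fundamental theorem of calculus at a single point of continuity, one-sided when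
  \<open>p = 0\<close>. The end point \<open>p + 1\<close> only supplies a compact interval with
  room to the right of \<open>p\<close>.\<close>

lemma limit_rate_has_derivative:
  assumes p: "0 \<le> p" and cont: "continuous (at p within {0..}) hl"
  shows "(limit_rate \<alpha> hl has_real_derivative \<alpha> * hl p) (at p within {0..})"
proof -
  have near: "at p within {0..} = at p within {0..p + 1}"
    by (rule at_within_nhd[of p "{p - 1<..<p + 1}"]) auto
  have "((\<lambda>u. integral {0..u} hl) has_vector_derivative hl p) (at p within ({0..p + 1} - {}))"
    using p cont near set_borel_integral_eq_integral(1)[OF hl_int[of "p + 1"]]
    by (intro integral_has_vector_derivative_continuous_at) auto
  then have "((\<lambda>u. integral {0..u} hl) has_real_derivative hl p) (at p within {0..})"
    by (simp add: has_real_derivative_iff_has_vector_derivative near)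
  then have "((\<lambda>u. \<alpha> * integral {0..u} hl) has_real_derivative \<alpha> * hl p) (at p within {0..})"
    by (rule DERIV_cmult)
  then show ?thesis
  proof (rule has_field_derivative_transform_within[of _ _ _ _ 1])
    fix u :: real assume "u \<in> {0..}"
    then show "\<alpha> * integral {0..u} hl = limit_rate \<alpha> hl u"
      by (simp add: limit_rate_def set_borel_integral_eq_integral(2)[OF hl_int])
  qed (use p in auto)
qed

text \<open>The half-open interval differs from the closed one by the orders at price exactly \<open>p\<close>,
  which may a priori be present in the initial book; continuity of the mean cumulative
  shape from the left shows that they do not contribute.\<close>

lemma cancelled_mean_closed:
  assumes p: "0 \<le> p" "p \<le> r"
    and cont: "continuous (at p within {0..}) (\<lambda>q. bd_mean \<mu> \<theta> (limit_rate \<alpha> hl q))"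
  shows "(LINT \<omega>|M. real (card (cancelled X ({p..r} \<times> {0<..1}) \<omega>))) =
      \<theta> * (bd_mean \<mu> \<theta> (limit_rate \<alpha> hl r) - bd_mean \<mu> \<theta> (limit_rate \<alpha> hl p))"
proof (cases "p = 0")
  \<comment> \<open>There is nothing to the left of price 0 to approximate from, but then
    \<open>{p..r}\<close> is itself an initial segment.\<close>
  case True
  have "{0..0::real} = {0}" by auto
  then have "limit_rate \<alpha> hl 0 = 0"
    using limit_rate_diff(2)[of 0 0] by (simp add: limit_rate_def)
  with True p show ?thesis
    by (simp add: cancelled_mean(2) bd_mean_0[OF mu theta])
next
  case False
  with p have pos: "0 < p" by simp
  let ?G = "\<lambda>q. bd_mean \<mu> \<theta> (limit_rate \<alpha> hl q)"
  let ?c = "\<lambda>A. LINT \<omega>|M. real (card (cancelled X (A \<times> {0<..1}) \<omega>))"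
  show ?thesis
  proof (rule antisym)
    have "(?G \<longlongrightarrow> ?G p) (at p within {0..})" using cont by (simp add: continuous_within)
    then have "(?G \<longlongrightarrow> ?G p) (at p within {0<..<p})" by (rule tendsto_within_subset) auto
    moreover have "at p within {0<..<p} = at_left p"
      by (rule at_within_nhd[of p "{0<..}"]) (use pos in auto)
    ultimately have "(?G \<longlongrightarrow> ?G p) (at_left p)" by simp
    then have "((\<lambda>q. \<theta> * (?G r - ?G q)) \<longlongrightarrow> \<theta> * (?G r - ?G p)) (at_left p)"
      by (intro tendsto_intros)
    moreover have "eventually (\<lambda>q. ?c {p..r} \<le> \<theta> * (?G r - ?G q)) (at_left p)"
      using eventually_at_left_real[OF pos]
    proof eventually_elim
      case (elim q)
      have "?c {p..r} \<le> ?c {q<..r}"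
        using elim p by (intro cancelled_mean_mono(2)[where q = r]) auto
      also have "\<dots> = \<theta> * (?G r - ?G q)"
        using elim p by (intro cancelled_mean_half_open) auto
      finally show ?case .
    qed
    ultimately show "?c {p..r} \<le> \<theta> * (?G r - ?G p)"
      by (rule tendsto_lowerbound) simp
    have "\<theta> * (?G r - ?G p) = ?c {p<..r}" using p by (intro cancelled_mean_half_open[symmetric])
    also have "\<dots> \<le> ?c {p..r}"
      using p by (intro cancelled_mean_mono(2)[where q = r]) auto
    finally show "\<theta> * (?G r - ?G p) \<le> ?c {p..r}" .
  qed
qed

text \<open>The fraction is \<open>\<theta>\<close> times a difference quotient of
  \<open>bd_mean\<close> between the rates at \<open>p\<close> and \<open>p + \<epsilon>\<close>, so
  its limit is \<open>\<theta> * D\<close>, unless the rate is constant just to the right of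
  \<open>p\<close> and the quotient degenerates.\<close>

lemma cancellation_limit:
  assumes p: "0 \<le> p" and cont: "continuous (at p within {0..}) hl"
  shows "\<exists>C. (cancelled_fraction M X p \<longlongrightarrow> C) (at_right 0) \<and>
    ((\<lambda>q. bd_mean \<mu> \<theta> (limit_rate \<alpha> hl q)) has_real_derivative \<alpha> * hl p / \<theta> * C) (at p within {0..})"
proof -
  let ?G = "bd_mean \<mu> \<theta>" and ?L = "limit_rate \<alpha> hl"
  note dL = limit_rate_has_derivative[OF p cont]
  obtain D where dG: "(?G has_real_derivative D) (at (?L p))"
    using bd_mean_differentiable[OF mu theta limit_rate_nonneg] by (auto simp: field_differentiable_def)
  have dGL: "((\<lambda>q. ?G (?L q)) has_real_derivative D * (\<alpha> * hl p)) (at p within {0..})"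
    using DERIV_chain2[OF dG dL] .
  \<comment> \<open>The Caratheodory form of the derivative replaces the difference quotient by a
    function \<open>g\<close> that is also defined where the increment of the rate is zero.\<close>
  obtain g where g: "\<And>z. ?G z - ?G (?L p) = g z * (z - ?L p)" "isCont g (?L p)" "g (?L p) = D"
    using dG unfolding CARAT_DERIV by blast
  have fraction: "cancelled_fraction M X p \<epsilon> = \<theta> * (g (?L (p + \<epsilon>)) * (?L (p + \<epsilon>) - ?L p)) / (?L (p + \<epsilon>) - ?L p)"
    if "0 < \<epsilon>" for \<epsilon>
  proof -
    have "continuous (at p within {0..}) (\<lambda>q. ?G (?L q))"
      using dGL by (rule DERIV_continuous)
    from cancelled_mean_closed[OF p _ this, of "p + \<epsilon>"] that
      submitted_mean(2)[of "{p..p + \<epsilon>}" "p + \<epsilon>"] limit_rate_diff(2)[OF p, of "p + \<epsilon>"] p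
    show ?thesis unfolding cancelled_fraction_def by (simp add: g(1))
  qed
  have shift: "filterlim (\<lambda>\<epsilon>. p + \<epsilon>) (at_right p) (at_right 0)"
    by (rule tendsto_imp_filterlim_at_right)
      (auto intro!: tendsto_eq_intros simp: eventually_at_filter)
  have right: "at_right p \<le> at p within {0..}"
    by (rule at_le) (use p in auto)
  \<comment> \<open>If some window to the right of \<open>p\<close> receives no submissions on
    average, monotonicity makes all smaller ones the same. The fraction is then
    \<open>0 / 0 = 0\<close>, and \<open>\<alpha> * hl p = 0\<close>, so \<open>C = 0\<close>
    works.\<close>
  show ?thesis
  proof (cases "\<exists>\<epsilon>>0. ?L (p + \<epsilon>) = ?L p")
    case True
    then obtain \<epsilon>0 where e0: "0 < \<epsilon>0" "?L (p + \<epsilon>0) = ?L p" by blast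
    have flat: "eventually (\<lambda>\<epsilon>. 0 < \<epsilon> \<and> ?L (p + \<epsilon>) = ?L p) (at_right 0)"
      using eventually_at_right_real[OF e0(1)]
    proof eventually_elim
      case (elim \<epsilon>)
      then show ?case
        using limit_rate_mono[of p "p + \<epsilon>"] limit_rate_mono[of "p + \<epsilon>" "p + \<epsilon>0"] p e0 by auto
    qed
    have "eventually (\<lambda>\<epsilon>. cancelled_fraction M X p \<epsilon> = 0) (at_right 0)"
      using flat by eventually_elim (simp add: fraction)
    then have "(cancelled_fraction M X p \<longlongrightarrow> 0) (at_right 0)" by (rule tendsto_eventually)
    moreover have zero: "\<alpha> * hl p = 0"
    proof -
      have "((\<lambda>q. (?L q - ?L p) / (q - p)) \<longlongrightarrow> \<alpha> * hl p) (at_right p)"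
        using dL by (intro tendsto_mono[OF right]) (simp add: has_field_derivative_iff)
      then have "((\<lambda>\<epsilon>. (?L (p + \<epsilon>) - ?L p) / (p + \<epsilon> - p)) \<longlongrightarrow> \<alpha> * hl p) (at_right 0)"
        by (rule filterlim_compose[OF _ shift])
      moreover have "((\<lambda>\<epsilon>. (?L (p + \<epsilon>) - ?L p) / (p + \<epsilon> - p)) \<longlongrightarrow> 0) (at_right 0)"
        using flat by (intro tendsto_eventually) (auto elim: eventually_mono)
      ultimately show ?thesis by (rule tendsto_unique[rotated]) simp
    qed
    ultimately show ?thesis using dGL unfolding zero by (intro exI[of _ 0]) simp
  next
    \<comment> \<open>Now the increment of the rate is nonzero for every
      \<open>\<epsilon> > 0\<close> and cancels, leaving \<open>\<theta> * g\<close> at the rate for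
      \<open>p + \<epsilon>\<close>.\<close>
    case False
    have "(?L \<longlongrightarrow> ?L p) (at p within {0..})"
      using DERIV_continuous[OF dL] by (simp add: continuous_within)
    then have "(?L \<longlongrightarrow> ?L p) (at_right p)" by (rule tendsto_mono[OF right])
    then have "((\<lambda>\<epsilon>. ?L (p + \<epsilon>)) \<longlongrightarrow> ?L p) (at_right 0)"
      by (rule filterlim_compose[OF _ shift])
    then have "((\<lambda>\<epsilon>. \<theta> * g (?L (p + \<epsilon>))) \<longlongrightarrow> \<theta> * D) (at_right 0)"
      using isCont_tendsto_compose[OF g(2)] unfolding g(3) by (intro tendsto_intros) auto
    moreover have "eventually (\<lambda>\<epsilon>. \<theta> * g (?L (p + \<epsilon>)) = cancelled_fraction M X p \<epsilon>) (at_right 0)"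
      using eventually_at_right_less[of 0]
      by eventually_elim (use False in \<open>auto simp: fraction\<close>)
    ultimately have "(cancelled_fraction M X p \<longlongrightarrow> \<theta> * D) (at_right 0)"
      by (rule Lim_transform_eventually)
    with dGL theta show ?thesis by (intro exI[of _ "\<theta> * D"]) (simp add: mult_ac)
  qed
qed

end

theorem proposition2:
  fixes M :: "'w measure" and F :: "real \<Rightarrow> 'w measure" and X :: "'w order_book"
    and hl h B :: "real \<Rightarrow> real" and \<alpha> \<mu> \<theta> p :: real
  assumes "\<alpha> \<ge> 0" and "\<mu> \<ge> 0" and "\<theta> > 0"
    and "\<And>u. u \<ge> 0 \<Longrightarrow> hl u \<ge> 0"
    and "\<And>q. q \<ge> 0 \<Longrightarrow> set_integrable lborel {0..q} hl"
    and "one_side_book M F X \<alpha> hl \<mu> \<theta>"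
    and "stationary_regime M X \<alpha> hl \<mu> \<theta>"
    and h: "\<And>u. h u = \<alpha> * hl u / \<theta>"
    and B: "\<And>q. B q = mean_cumulative_shape \<alpha> hl \<mu> \<theta> q"
    and "p \<ge> 0" and "continuous (at p within {0..}) hl"
  shows "(cancelled_fraction M X p \<longlongrightarrow> cancel_prob M X p) (at_right 0) \<and>
    (B has_real_derivative h p * cancel_prob M X p) (at p within {0..})"
proof -
  obtain C where C: "(cancelled_fraction M X p \<longlongrightarrow> C) (at_right 0)"
    "((\<lambda>q. bd_mean \<mu> \<theta> (limit_rate \<alpha> hl q)) has_real_derivative \<alpha> * hl p / \<theta> * C) (at p within {0..})"
    using cancellation_limit[of \<alpha> \<mu> \<theta> hl M F X p] assms by blast
  have "cancel_prob M X p = C"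
    unfolding cancel_prob_def using C(1) by (intro tendsto_Lim) auto
  \<comment> \<open>The equality covers negative \<open>q\<close> too: there the price interval is
    empty and the rate is 0.\<close>
  moreover have "B = (\<lambda>q. bd_mean \<mu> \<theta> (limit_rate \<alpha> hl q))"
  proof
    fix q
    have "0 \<le> limit_rate \<alpha> hl q"
      unfolding limit_rate_def set_lebesgue_integral_def using assms(1,4)
      by (intro mult_nonneg_nonneg Bochner_Integration.integral_nonneg) (auto simp: indicator_def)
    then show "B q = bd_mean \<mu> \<theta> (limit_rate \<alpha> hl q)"
      unfolding B mean_cumulative_shape_def using assms(2,3) by (intro book_law_mean(2))
  qed
  ultimately show ?thesis using C by (simp add: h)
qed

end
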